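(* Let $(\overline{M},\overline{g},J)$ be a locally metallic Riemannian manifold. If $M:=M_T\times_f M_\theta$ is a warped product pointwise semi-slant submanifold of $\overline{M}$, where the base $M_T$ is an invariant submanifold and the fiber $M_\theta$ is a pointwise slant submanifold with pointwise slant angle $\theta_x\in(0,\frac{\pi}{2})$ for $x\in M_\theta$, then the warping function $f$ is constant on the connected components of $M_T$.
   Context: A metallic Riemannian manifold $(\overline{M},\overline{g},J)$ is a Riemannian manifold $(\overline{M},\overline{g})$ with a $(1,1)$-tensor field $J$ such that $J^2=pJ+qI$ for some positive integers $p,q$ and $\overline{g}(JX,Y)=\overline{g}(X,JY)$ for all vector fields $X,Y$. It is locally metallic if $\overline{\nabla}J=0$, where $\overline{\nabla}$ is the Levi-Civita connection of $\overline{g}$. For an isometrically immersed submanifold $M$ of $\overline{M}$ and $X\in\Gamma(TM)$ write $JX=TX+NX$ with $TX$ tangent and $NX$ normal to $M$. A submanifold is invariant if $J$ maps its tangent spaces into themselves. A distribution $D$ on $M$ is pointwise slant if for every $x\in M$ the angle $\theta_x$ between $JX$ and $D_x$ is the same for all nonzero $X\in D_x$; $x\mapsto\theta_x$ is its slant (Wirtinger) function. A submanifold is pointwise slant if its whole tangent bundle has this property, i.e. $\cos\theta_x=\|TX\|/\|JX\|$ for all nonzero $X\in T_xM$. $M$ is a pointwise bi-slant submanifold if there are orthogonal distributions $D_1,D_2$ on $M$ with $TM=D_1\oplus D_2$, $J(D_1)\perp D_2$, $J(D_2)\perp D_1$, and $D_1,D_2$ pointwise slant. The warped product $M_1\times_f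 M_2$ of Riemannian manifolds $(M_1,g_1)$ (the base) and $(M_2,g_2)$ (the fiber), both of positive dimension, with warping function a smooth $f:M_1\to(0,\infty)$ is $M_1\times M_2$ with metric $g=\pi_1^*g_1+(f\circ\pi_1)^2\pi_2^*g_2$, $\pi_i$ being the projections. A warped product pointwise bi-slant submanifold of $\overline{M}$ is a warped product $M_1\times_f M_2$ of two pointwise slant submanifolds $M_1,M_2$ of $\overline{M}$, isometrically immersed in $\overline{M}$ as a pointwise bi-slant submanifold with $D_1=TM_1$, $D_2=TM_2$. It is called a warped product pointwise semi-slant submanifold if one of $M_1,M_2$ is an invariant submanifold of $\overline{M}$ and the other is a pointwise slant submanifold of $\overline{M}$ with Wirtinger angle $\theta_x\in[0,\frac{\pi}{2}]$.
   Formalization: The slant angle is taken to be a function on the fiber M_θ alone, the same for every leaf {x}×M_θ; if it may also vary with the base point, the claim fails (e.g. f = √(r²+t²) for an immersion into R²×R² with J = s⊕s'). *)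

theory Defs
  imports "HOL-Analysis.Analysis" "HOL-Library.Function_Algebras"
begin

section \<open>Smooth maps between Euclidean spaces\<close>

text \<open>Used only for open \<open>S\<close> in finite dimension, where \<open>Ck_on k S f\<close> says that \<open>f\<close> is
  \<open>k\<close> times continuously differentiable: all iterated directional derivatives up to order \<open>k\<close>
  exist and are continuous.\<close>

primrec Ck_on :: "nat \<Rightarrow> 'a::real_normed_vector set \<Rightarrow> ('a \<Rightarrow> 'b::real_normed_vector) \<Rightarrow> bool" where
  "Ck_on 0 S f \<longleftrightarrow> continuous_on S f"
| "Ck_on (Suc k) S f \<longleftrightarrow> (\<forall>x\<in>S. f differentiable (at x)) \<and>
      (\<forall>v. Ck_on k S (\<lambda>x. frechet_derivative f (at x) v))"

definition smooth_on :: "'a::real_normed_vector set \<Rightarrow> ('a \<Rightarrow> 'b::real_normed_vector) \<Rightarrow> bool" where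
  "smooth_on S f \<longleftrightarrow> (\<forall>k. Ck_on k S f)"


section \<open>Smooth manifolds\<close>

text \<open>The points of a manifold are the elements of a Hausdorff, second countable topological type
  \<open>'m\<close>; the smooth structure is given by an atlas modelled on the Euclidean space \<open>'a\<close>, whose
  dimension is positive. Atlases need not be maximal. A chart is a pair of its open
  domain and its coordinate map, which is irrelevant outside the domain.\<close>

type_synonym ('m, 'a) chart = "'m set \<times> ('m \<Rightarrow> 'a)"

abbreviation cdom :: "('m, 'a) chart \<Rightarrow> 'm set" where "cdom c \<equiv> fst c"
abbreviation cmap :: "('m, 'a) chart \<Rightarrow> 'm \<Rightarrow> 'a" where "cmap c \<equiv> snd c"
abbreviation cinv :: "('m, 'a) chart \<Rightarrow> 'a \<Rightarrow> 'm" where "cinv c \<equiv> inv_into (cdom c) (cmap c)"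

definition is_chart :: "('m::topological_space, 'a::euclidean_space) chart \<Rightarrow> bool" where
  "is_chart c \<longleftrightarrow> open (cdom c) \<and> open (cmap c ` cdom c) \<and>
     homeomorphism (cdom c) (cmap c ` cdom c) (cmap c) (cinv c)"

definition smooth_manifold ::
  "('m::{t2_space, second_countable_topology}, 'a::euclidean_space) chart set \<Rightarrow> bool" where
  "smooth_manifold A \<longleftrightarrow> (\<forall>c\<in>A. is_chart c) \<and> (\<Union>c\<in>A. cdom c) = UNIV \<and>
     (\<forall>c\<in>A. \<forall>d\<in>A. smooth_on (cmap c ` (cdom c \<inter> cdom d)) (cmap d \<circ> cinv c))"

text \<open>Any chart around \<open>p\<close>; nothing below depends on the choice.\<close>

definition chart_at :: "('m, 'a) chart set \<Rightarrow> 'm \<Rightarrow> ('m, 'a) chart" where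
  "chart_at A p = (SOME c. c \<in> A \<and> p \<in> cdom c)"

definition prod_atlas :: "('m, 'a) chart set \<Rightarrow> ('n, 'b) chart set \<Rightarrow> ('m \<times> 'n, 'a \<times> 'b) chart set" where
  "prod_atlas A B = (\<lambda>(c, d). (cdom c \<times> cdom d, map_prod (cmap c) (cmap d))) ` (A \<times> B)"

definition smooth_fun ::
  "('m::topological_space, 'a::euclidean_space) chart set \<Rightarrow> 'm set \<Rightarrow> ('m \<Rightarrow> real) \<Rightarrow> bool" where
  "smooth_fun A U h \<longleftrightarrow> (\<forall>c\<in>A. smooth_on (cmap c ` (U \<inter> cdom c)) (h \<circ> cinv c))"

definition smooth_map ::
  "('m::topological_space, 'a::euclidean_space) chart set \<Rightarrow>
   ('n::topological_space, 'b::euclidean_space) chart set \<Rightarrow> ('m \<Rightarrow> 'n) \<Rightarrow> bool" where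
  "smooth_map A B F \<longleftrightarrow> continuous_on UNIV F \<and>
     (\<forall>c\<in>A. \<forall>d\<in>B. smooth_on (cmap c ` (cdom c \<inter> F -` cdom d)) (cmap d \<circ> F \<circ> cinv c))"


section \<open>Tangent vectors, differentials and vector fields\<close>

text \<open>A tangent vector at \<open>p\<close> is the family of its coordinate vectors in the charts around \<open>p\<close>,
  which transform by the differentials of the chart changes; at all other charts the family is
  set to zero, so that tangent vectors are equal if and only if they are equal as functions.
  The linear operations are pointwise.\<close>

instantiation "fun" :: (type, real_vector) real_vector
begin
definition scaleR_fun :: "real \<Rightarrow> ('a \<Rightarrow> 'b) \<Rightarrow> 'a \<Rightarrow> 'b" where
  "scaleR_fun r f = (\<lambda>x. r *\<^sub>R f x)"
instance
  by standard (simp_all add: scaleR_fun_def fun_eq_iff scaleR_add_right scaleR_add_left)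
end

type_synonym ('m, 'a) tvec = "('m, 'a) chart \<Rightarrow> 'a"

definition tangent_space :: "('m, 'a::euclidean_space) chart set \<Rightarrow> 'm \<Rightarrow> ('m, 'a) tvec set" where
  "tangent_space A p = {X.
     (\<forall>c\<in>A. \<forall>d\<in>A. p \<in> cdom c \<longrightarrow> p \<in> cdom d \<longrightarrow>
        X d = frechet_derivative (cmap d \<circ> cinv c) (at (cmap c p)) (X c)) \<and>
     (\<forall>c. \<not> (c \<in> A \<and> p \<in> cdom c) \<longrightarrow> X c = 0)}"

definition differential ::
  "('m, 'a::euclidean_space) chart set \<Rightarrow> ('n, 'b::euclidean_space) chart set \<Rightarrow> ('m \<Rightarrow> 'n) \<Rightarrow> 'm \<Rightarrow>
   ('m, 'a) tvec \<Rightarrow> ('n, 'b) tvec" where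
  "differential A B F p X = (\<lambda>d. if d \<in> B \<and> F p \<in> cdom d
     then frechet_derivative (cmap d \<circ> F \<circ> cinv (chart_at A p)) (at (cmap (chart_at A p) p))
            (X (chart_at A p))
     else 0)"

text \<open>The derivative \<open>X h\<close> of a real function \<open>h\<close> along the tangent vector \<open>X\<close> at \<open>p\<close>.\<close>

definition dir_deriv ::
  "('m, 'a::euclidean_space) chart set \<Rightarrow> 'm \<Rightarrow> ('m, 'a) tvec \<Rightarrow> ('m \<Rightarrow> real) \<Rightarrow> real" where
  "dir_deriv A p X h =
     frechet_derivative (h \<circ> cinv (chart_at A p)) (at (cmap (chart_at A p) p)) (X (chart_at A p))"

definition smooth_vector_field ::
  "('m::topological_space, 'a::euclidean_space) chart set \<Rightarrow> 'm set \<Rightarrow>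
   ('m \<Rightarrow> ('m, 'a) tvec) \<Rightarrow> bool" where
  "smooth_vector_field A U X \<longleftrightarrow> (\<forall>p\<in>U. X p \<in> tangent_space A p) \<and>
     (\<forall>c\<in>A. smooth_on (cmap c ` (U \<inter> cdom c)) (\<lambda>u. X (cinv c u) c))"

text \<open>A distribution is a smooth subbundle of the tangent bundle: near every point it has a
  smooth frame.\<close>

definition distribution ::
  "('m::topological_space, 'a::euclidean_space) chart set \<Rightarrow> ('m \<Rightarrow> ('m, 'a) tvec set) \<Rightarrow> bool" where
  "distribution A D \<longleftrightarrow> (\<forall>p. \<exists>U k (E :: nat \<Rightarrow> 'm \<Rightarrow> ('m, 'a) tvec).
     open U \<and> p \<in> U \<and> (\<forall>i<k. smooth_vector_field A U (E i)) \<and>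
     (\<forall>q\<in>U. inj_on (\<lambda>i. E i q) {..<k} \<and> independent ((\<lambda>i. E i q) ` {..<k}) \<and>
            D q = span ((\<lambda>i. E i q) ` {..<k})))"


section \<open>Riemannian metrics and the Levi-Civita connection\<close>

definition riemannian_metric ::
  "('m::topological_space, 'a::euclidean_space) chart set \<Rightarrow>
   ('m \<Rightarrow> ('m, 'a) tvec \<Rightarrow> ('m, 'a) tvec \<Rightarrow> real) \<Rightarrow> bool" where
  "riemannian_metric A g \<longleftrightarrow>
     (\<forall>p. \<forall>X\<in>tangent_space A p. \<forall>Y\<in>tangent_space A p. g p X Y = g p Y X) \<and>
     (\<forall>p. \<forall>X\<in>tangent_space A p. \<forall>Y\<in>tangent_space A p. \<forall>Z\<in>tangent_space A p. \<forall>r.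
        g p (r *\<^sub>R X + Y) Z = r * g p X Z + g p Y Z) \<and>
     (\<forall>p. \<forall>X\<in>tangent_space A p. X \<noteq> 0 \<longrightarrow> g p X X > 0) \<and>
     (\<forall>U X Y. open U \<longrightarrow> smooth_vector_field A U X \<longrightarrow> smooth_vector_field A U Y \<longrightarrow>
        smooth_fun A U (\<lambda>q. g q (X q) (Y q)))"

definition riemannian_manifold ::
  "('m::{t2_space, second_countable_topology}, 'a::euclidean_space) chart set \<Rightarrow>
   ('m \<Rightarrow> ('m, 'a) tvec \<Rightarrow> ('m, 'a) tvec \<Rightarrow> real) \<Rightarrow> bool" where
  "riemannian_manifold A g \<longleftrightarrow> smooth_manifold A \<and> riemannian_metric A g"

text \<open>A linear connection on the tangent bundle, as the local operator it is: it acts on smooth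
  vector fields over arbitrary open sets, compatibly with restriction. A field over \<open>U\<close> is
  represented by a function whose values outside \<open>U\<close> are irrelevant.\<close>

definition affine_connection ::
  "('m::topological_space, 'a::euclidean_space) chart set \<Rightarrow>
   (('m \<Rightarrow> ('m, 'a) tvec) \<Rightarrow> ('m \<Rightarrow> ('m, 'a) tvec) \<Rightarrow> 'm \<Rightarrow> ('m, 'a) tvec) \<Rightarrow> bool" where
  "affine_connection A nab \<longleftrightarrow> (\<forall>U. open U \<longrightarrow>
     (\<forall>X Y. smooth_vector_field A U X \<longrightarrow> smooth_vector_field A U Y \<longrightarrow>
        smooth_vector_field A U (nab X Y)) \<and>
     (\<forall>X Y X' Y'. smooth_vector_field A U X \<longrightarrow> smooth_vector_field A U Y \<longrightarrow>
        smooth_vector_field A U X' \<longrightarrow> smooth_vector_field A U Y' \<longrightarrow>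
        (\<forall>p\<in>U. X p = X' p \<and> Y p = Y' p) \<longrightarrow> (\<forall>p\<in>U. nab X Y p = nab X' Y' p)) \<and>
     (\<forall>X Y Z h. smooth_vector_field A U X \<longrightarrow> smooth_vector_field A U Y \<longrightarrow>
        smooth_vector_field A U Z \<longrightarrow> smooth_fun A U h \<longrightarrow> (\<forall>p\<in>U.
          nab (\<lambda>q. h q *\<^sub>R X q + Y q) Z p = h p *\<^sub>R nab X Z p + nab Y Z p \<and>
          nab X (\<lambda>q. h q *\<^sub>R Y q + Z q) p =
            dir_deriv A p (X p) h *\<^sub>R Y p + h p *\<^sub>R nab X Y p + nab X Z p)))"

text \<open>Torsion-freeness \<open>\<nabla>\<^sub>X Y - \<nabla>\<^sub>Y X = [X, Y]\<close> is stated by letting both sides act on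
  functions: \<open>[X, Y] h = X (Y h) - Y (X h)\<close>.\<close>

definition torsion_free ::
  "('m::topological_space, 'a::euclidean_space) chart set \<Rightarrow>
   (('m \<Rightarrow> ('m, 'a) tvec) \<Rightarrow> ('m \<Rightarrow> ('m, 'a) tvec) \<Rightarrow> 'm \<Rightarrow> ('m, 'a) tvec) \<Rightarrow> bool" where
  "torsion_free A nab \<longleftrightarrow> (\<forall>U X Y h. open U \<longrightarrow> smooth_vector_field A U X \<longrightarrow>
     smooth_vector_field A U Y \<longrightarrow> smooth_fun A U h \<longrightarrow> (\<forall>p\<in>U.
       dir_deriv A p (nab X Y p - nab Y X p) h =
         dir_deriv A p (X p) (\<lambda>q. dir_deriv A q (Y q) h)
       - dir_deriv A p (Y p) (\<lambda>q. dir_deriv A q (X q) h)))"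

definition metric_connection ::
  "('m::topological_space, 'a::euclidean_space) chart set \<Rightarrow>
   ('m \<Rightarrow> ('m, 'a) tvec \<Rightarrow> ('m, 'a) tvec \<Rightarrow> real) \<Rightarrow>
   (('m \<Rightarrow> ('m, 'a) tvec) \<Rightarrow> ('m \<Rightarrow> ('m, 'a) tvec) \<Rightarrow> 'm \<Rightarrow> ('m, 'a) tvec) \<Rightarrow> bool" where
  "metric_connection A g nab \<longleftrightarrow> (\<forall>U X Y Z. open U \<longrightarrow> smooth_vector_field A U X \<longrightarrow>
     smooth_vector_field A U Y \<longrightarrow> smooth_vector_field A U Z \<longrightarrow> (\<forall>p\<in>U.
       dir_deriv A p (X p) (\<lambda>q. g q (Y q) (Z q)) =
         g p (nab X Y p) (Z p) + g p (Y p) (nab X Z p)))"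

definition levi_civita ::
  "('m::topological_space, 'a::euclidean_space) chart set \<Rightarrow>
   ('m \<Rightarrow> ('m, 'a) tvec \<Rightarrow> ('m, 'a) tvec \<Rightarrow> real) \<Rightarrow>
   (('m \<Rightarrow> ('m, 'a) tvec) \<Rightarrow> ('m \<Rightarrow> ('m, 'a) tvec) \<Rightarrow> 'm \<Rightarrow> ('m, 'a) tvec) \<Rightarrow> bool" where
  "levi_civita A g nab \<longleftrightarrow> affine_connection A nab \<and> torsion_free A nab \<and> metric_connection A g nab"


section \<open>Metallic Riemannian manifolds\<close>

definition tensor_field_1_1 ::
  "('m::topological_space, 'a::euclidean_space) chart set \<Rightarrow>
   ('m \<Rightarrow> ('m, 'a) tvec \<Rightarrow> ('m, 'a) tvec) \<Rightarrow> bool" where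
  "tensor_field_1_1 A J \<longleftrightarrow>
     (\<forall>p. \<forall>X\<in>tangent_space A p. J p X \<in> tangent_space A p) \<and>
     (\<forall>p. \<forall>X\<in>tangent_space A p. \<forall>Y\<in>tangent_space A p. \<forall>r.
        J p (r *\<^sub>R X + Y) = r *\<^sub>R J p X + J p Y) \<and>
     (\<forall>U X. open U \<longrightarrow> smooth_vector_field A U X \<longrightarrow>
        smooth_vector_field A U (\<lambda>q. J q (X q)))"

definition metallic_riemannian ::
  "('m::{t2_space, second_countable_topology}, 'a::euclidean_space) chart set \<Rightarrow>
   ('m \<Rightarrow> ('m, 'a) tvec \<Rightarrow> ('m, 'a) tvec \<Rightarrow> real) \<Rightarrow>
   ('m \<Rightarrow> ('m, 'a) tvec \<Rightarrow> ('m, 'a) tvec) \<Rightarrow> bool" where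
  "metallic_riemannian A g J \<longleftrightarrow> riemannian_manifold A g \<and> tensor_field_1_1 A J \<and>
     (\<exists>a b :: nat. a > 0 \<and> b > 0 \<and>
        (\<forall>p. \<forall>X\<in>tangent_space A p. J p (J p X) = real a *\<^sub>R J p X + real b *\<^sub>R X)) \<and>
     (\<forall>p. \<forall>X\<in>tangent_space A p. \<forall>Y\<in>tangent_space A p. g p (J p X) Y = g p X (J p Y))"

text \<open>\<open>\<nabla>J = 0\<close>, i.e. \<open>(\<nabla>\<^sub>X J) Y = \<nabla>\<^sub>X (J Y) - J (\<nabla>\<^sub>X Y)\<close> vanishes.\<close>

definition parallel_1_1 ::
  "('m::topological_space, 'a::euclidean_space) chart set \<Rightarrow>
   (('m \<Rightarrow> ('m, 'a) tvec) \<Rightarrow> ('m \<Rightarrow> ('m, 'a) tvec) \<Rightarrow> 'm \<Rightarrow> ('m, 'a) tvec) \<Rightarrow>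
   ('m \<Rightarrow> ('m, 'a) tvec \<Rightarrow> ('m, 'a) tvec) \<Rightarrow> bool" where
  "parallel_1_1 A nab J \<longleftrightarrow> (\<forall>U X Y. open U \<longrightarrow> smooth_vector_field A U X \<longrightarrow>
     smooth_vector_field A U Y \<longrightarrow> (\<forall>p\<in>U. nab X (\<lambda>q. J q (Y q)) p - J p (nab X Y p) = 0))"

definition locally_metallic ::
  "('m::{t2_space, second_countable_topology}, 'a::euclidean_space) chart set \<Rightarrow>
   ('m \<Rightarrow> ('m, 'a) tvec \<Rightarrow> ('m, 'a) tvec \<Rightarrow> real) \<Rightarrow>
   ('m \<Rightarrow> ('m, 'a) tvec \<Rightarrow> ('m, 'a) tvec) \<Rightarrow> bool" where
  "locally_metallic A g J \<longleftrightarrow> metallic_riemannian A g J \<and>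
     (\<exists>nab. levi_civita A g nab \<and> parallel_1_1 A nab J)"


section \<open>Submanifolds\<close>

text \<open>A submanifold is given by an immersion \<open>\<phi>\<close>; \<open>A\<close> is the atlas of the submanifold and \<open>B\<close>
  that of the ambient manifold.\<close>

definition immersion ::
  "('m::topological_space, 'a::euclidean_space) chart set \<Rightarrow>
   ('n::topological_space, 'b::euclidean_space) chart set \<Rightarrow> ('m \<Rightarrow> 'n) \<Rightarrow> bool" where
  "immersion A B \<phi> \<longleftrightarrow> smooth_map A B \<phi> \<and>
     (\<forall>p. inj_on (differential A B \<phi> p) (tangent_space A p))"

definition isometric_immersion ::
  "('m::topological_space, 'a::euclidean_space) chart set \<Rightarrow>
   ('m \<Rightarrow> ('m, 'a) tvec \<Rightarrow> ('m, 'a) tvec \<Rightarrow> real) \<Rightarrow>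
   ('n::topological_space, 'b::euclidean_space) chart set \<Rightarrow>
   ('n \<Rightarrow> ('n, 'b) tvec \<Rightarrow> ('n, 'b) tvec \<Rightarrow> real) \<Rightarrow> ('m \<Rightarrow> 'n) \<Rightarrow> bool" where
  "isometric_immersion A g B gb \<phi> \<longleftrightarrow> immersion A B \<phi> \<and>
     (\<forall>p. \<forall>X\<in>tangent_space A p. \<forall>Y\<in>tangent_space A p.
        gb (\<phi> p) (differential A B \<phi> p X) (differential A B \<phi> p Y) = g p X Y)"

definition invariant_submanifold ::
  "('m::topological_space, 'a::euclidean_space) chart set \<Rightarrow>
   ('n::topological_space, 'b::euclidean_space) chart set \<Rightarrow>
   ('n \<Rightarrow> ('n, 'b) tvec \<Rightarrow> ('n, 'b) tvec) \<Rightarrow> ('m \<Rightarrow> 'n) \<Rightarrow> bool" where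
  "invariant_submanifold A B J \<phi> \<longleftrightarrow> immersion A B \<phi> \<and>
     (\<forall>p. \<forall>X\<in>tangent_space A p.
        J (\<phi> p) (differential A B \<phi> p X) \<in> differential A B \<phi> p ` tangent_space A p)"

text \<open>Orthogonal projection to the linear subspace \<open>W\<close>, and the angle between the nonzero vector
  \<open>v\<close> and \<open>W\<close>, with respect to the inner product \<open>s\<close>.\<close>

definition orth_proj :: "('v::real_vector \<Rightarrow> 'v \<Rightarrow> real) \<Rightarrow> 'v set \<Rightarrow> 'v \<Rightarrow> 'v" where
  "orth_proj s W v = (THE w. w \<in> W \<and> (\<forall>u\<in>W. s (v - w) u = 0))"

definition subspace_angle :: "('v::real_vector \<Rightarrow> 'v \<Rightarrow> real) \<Rightarrow> 'v set \<Rightarrow> 'v \<Rightarrow> real" where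
  "subspace_angle s W v =
     arccos (sqrt (s (orth_proj s W v) (orth_proj s W v)) / sqrt (s v v))"

definition pointwise_slant_distribution ::
  "('m::topological_space, 'a::euclidean_space) chart set \<Rightarrow>
   ('n::topological_space, 'b::euclidean_space) chart set \<Rightarrow>
   ('n \<Rightarrow> ('n, 'b) tvec \<Rightarrow> ('n, 'b) tvec \<Rightarrow> real) \<Rightarrow>
   ('n \<Rightarrow> ('n, 'b) tvec \<Rightarrow> ('n, 'b) tvec) \<Rightarrow> ('m \<Rightarrow> 'n) \<Rightarrow>
   ('m \<Rightarrow> ('m, 'a) tvec set) \<Rightarrow> ('m \<Rightarrow> real) \<Rightarrow> bool" where
  "pointwise_slant_distribution A B gb J \<phi> D \<theta> \<longleftrightarrow> (\<forall>p. \<forall>X\<in>D p. X \<noteq> 0 \<longrightarrow>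
     subspace_angle (gb (\<phi> p)) (differential A B \<phi> p ` D p)
       (J (\<phi> p) (differential A B \<phi> p X)) = \<theta> p)"

definition pointwise_slant_submanifold ::
  "('m::topological_space, 'a::euclidean_space) chart set \<Rightarrow>
   ('n::topological_space, 'b::euclidean_space) chart set \<Rightarrow>
   ('n \<Rightarrow> ('n, 'b) tvec \<Rightarrow> ('n, 'b) tvec \<Rightarrow> real) \<Rightarrow>
   ('n \<Rightarrow> ('n, 'b) tvec \<Rightarrow> ('n, 'b) tvec) \<Rightarrow> ('m \<Rightarrow> 'n) \<Rightarrow> ('m \<Rightarrow> real) \<Rightarrow> bool" where
  "pointwise_slant_submanifold A B gb J \<phi> \<theta> \<longleftrightarrow> immersion A B \<phi> \<and>
     pointwise_slant_distribution A B gb J \<phi> (tangent_space A) \<theta>"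

definition pointwise_bi_slant ::
  "('m::topological_space, 'a::euclidean_space) chart set \<Rightarrow>
   ('m \<Rightarrow> ('m, 'a) tvec \<Rightarrow> ('m, 'a) tvec \<Rightarrow> real) \<Rightarrow>
   ('n::topological_space, 'b::euclidean_space) chart set \<Rightarrow>
   ('n \<Rightarrow> ('n, 'b) tvec \<Rightarrow> ('n, 'b) tvec \<Rightarrow> real) \<Rightarrow>
   ('n \<Rightarrow> ('n, 'b) tvec \<Rightarrow> ('n, 'b) tvec) \<Rightarrow> ('m \<Rightarrow> 'n) \<Rightarrow>
   ('m \<Rightarrow> ('m, 'a) tvec set) \<Rightarrow> ('m \<Rightarrow> ('m, 'a) tvec set) \<Rightarrow> bool" where
  "pointwise_bi_slant A g B gb J \<phi> D1 D2 \<longleftrightarrow>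
     isometric_immersion A g B gb \<phi> \<and> distribution A D1 \<and> distribution A D2 \<and>
     (\<forall>p. tangent_space A p = {X + Y | X Y. X \<in> D1 p \<and> Y \<in> D2 p} \<and> D1 p \<inter> D2 p = {0} \<and>
        (\<forall>X\<in>D1 p. \<forall>Y\<in>D2 p. g p X Y = 0 \<and>
           gb (\<phi> p) (J (\<phi> p) (differential A B \<phi> p X)) (differential A B \<phi> p Y) = 0 \<and>
           gb (\<phi> p) (J (\<phi> p) (differential A B \<phi> p Y)) (differential A B \<phi> p X) = 0)) \<and>
     (\<exists>\<theta>. pointwise_slant_distribution A B gb J \<phi> D1 \<theta>) \<and>
     (\<exists>\<theta>. pointwise_slant_distribution A B gb J \<phi> D2 \<theta>)"


section \<open>Warped products\<close>

definition warped_metric ::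
  "('m::topological_space, 'a::euclidean_space) chart set \<Rightarrow>
   ('m \<Rightarrow> ('m, 'a) tvec \<Rightarrow> ('m, 'a) tvec \<Rightarrow> real) \<Rightarrow>
   ('n::topological_space, 'b::euclidean_space) chart set \<Rightarrow>
   ('n \<Rightarrow> ('n, 'b) tvec \<Rightarrow> ('n, 'b) tvec \<Rightarrow> real) \<Rightarrow> ('m \<Rightarrow> real) \<Rightarrow>
   'm \<times> 'n \<Rightarrow> ('m \<times> 'n, 'a \<times> 'b) tvec \<Rightarrow> ('m \<times> 'n, 'a \<times> 'b) tvec \<Rightarrow> real" where
  "warped_metric A1 g1 A2 g2 f p X Y =
     g1 (fst p) (differential (prod_atlas A1 A2) A1 fst p X)
                (differential (prod_atlas A1 A2) A1 fst p Y) +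
     (f (fst p))\<^sup>2 *
     g2 (snd p) (differential (prod_atlas A1 A2) A2 snd p X)
                (differential (prod_atlas A1 A2) A2 snd p Y)"

text \<open>The tangent bundles of the two factors, as distributions on the product.\<close>

definition factor1_tangent ::
  "('m, 'a::euclidean_space) chart set \<Rightarrow> ('n, 'b::euclidean_space) chart set \<Rightarrow>
   'm \<times> 'n \<Rightarrow> ('m \<times> 'n, 'a \<times> 'b) tvec set" where
  "factor1_tangent A1 A2 p =
     differential A1 (prod_atlas A1 A2) (\<lambda>x. (x, snd p)) (fst p) ` tangent_space A1 (fst p)"

definition factor2_tangent ::
  "('m, 'a::euclidean_space) chart set \<Rightarrow> ('n, 'b::euclidean_space) chart set \<Rightarrow>
   'm \<times> 'n \<Rightarrow> ('m \<times> 'n, 'a \<times> 'b) tvec set" where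
  "factor2_tangent A1 A2 p =
     differential A2 (prod_atlas A1 A2) (\<lambda>y. (fst p, y)) (snd p) ` tangent_space A2 (snd p)"

text \<open>The factors are submanifolds of the ambient manifold through the leaves
  \<open>M\<^sub>1 \<times> {y}\<close> and \<open>{x} \<times> M\<^sub>2\<close> of the product. Their slant functions \<open>\<theta>1\<close> and \<open>\<theta>2\<close> are
  functions on \<open>M\<^sub>1\<close> and on \<open>M\<^sub>2\<close> respectively, and so the same for all leaves.\<close>

definition warped_product_pw_bi_slant ::
  "('m::{t2_space, second_countable_topology}, 'a::euclidean_space) chart set \<Rightarrow>
   ('m \<Rightarrow> ('m, 'a) tvec \<Rightarrow> ('m, 'a) tvec \<Rightarrow> real) \<Rightarrow>
   ('n::{t2_space, second_countable_topology}, 'b::euclidean_space) chart set \<Rightarrow>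
   ('n \<Rightarrow> ('n, 'b) tvec \<Rightarrow> ('n, 'b) tvec \<Rightarrow> real) \<Rightarrow> ('m \<Rightarrow> real) \<Rightarrow>
   ('k::{t2_space, second_countable_topology}, 'c::euclidean_space) chart set \<Rightarrow>
   ('k \<Rightarrow> ('k, 'c) tvec \<Rightarrow> ('k, 'c) tvec \<Rightarrow> real) \<Rightarrow>
   ('k \<Rightarrow> ('k, 'c) tvec \<Rightarrow> ('k, 'c) tvec) \<Rightarrow> ('m \<times> 'n \<Rightarrow> 'k) \<Rightarrow>
   ('m \<Rightarrow> real) \<Rightarrow> ('n \<Rightarrow> real) \<Rightarrow> bool" where
  "warped_product_pw_bi_slant A1 g1 A2 g2 f B gb J \<phi> \<theta>1 \<theta>2 \<longleftrightarrow>
     riemannian_manifold A1 g1 \<and> riemannian_manifold A2 g2 \<and>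
     smooth_fun A1 UNIV f \<and> (\<forall>x. f x > 0) \<and>
     pointwise_bi_slant (prod_atlas A1 A2) (warped_metric A1 g1 A2 g2 f) B gb J \<phi>
       (factor1_tangent A1 A2) (factor2_tangent A1 A2) \<and>
     (\<forall>y. pointwise_slant_submanifold A1 B gb J (\<lambda>x. \<phi> (x, y)) \<theta>1) \<and>
     (\<forall>x. pointwise_slant_submanifold A2 B gb J (\<lambda>y. \<phi> (x, y)) \<theta>2)"

definition warped_product_pw_semi_slant ::
  "('m::{t2_space, second_countable_topology}, 'a::euclidean_space) chart set \<Rightarrow>
   ('m \<Rightarrow> ('m, 'a) tvec \<Rightarrow> ('m, 'a) tvec \<Rightarrow> real) \<Rightarrow>
   ('n::{t2_space, second_countable_topology}, 'b::euclidean_space) chart set \<Rightarrow>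
   ('n \<Rightarrow> ('n, 'b) tvec \<Rightarrow> ('n, 'b) tvec \<Rightarrow> real) \<Rightarrow> ('m \<Rightarrow> real) \<Rightarrow>
   ('k::{t2_space, second_countable_topology}, 'c::euclidean_space) chart set \<Rightarrow>
   ('k \<Rightarrow> ('k, 'c) tvec \<Rightarrow> ('k, 'c) tvec \<Rightarrow> real) \<Rightarrow>
   ('k \<Rightarrow> ('k, 'c) tvec \<Rightarrow> ('k, 'c) tvec) \<Rightarrow> ('m \<times> 'n \<Rightarrow> 'k) \<Rightarrow>
   ('m \<Rightarrow> real) \<Rightarrow> ('n \<Rightarrow> real) \<Rightarrow> bool" where
  "warped_product_pw_semi_slant A1 g1 A2 g2 f B gb J \<phi> \<theta>1 \<theta>2 \<longleftrightarrow>
     warped_product_pw_bi_slant A1 g1 A2 g2 f B gb J \<phi> \<theta>1 \<theta>2 \<and>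
     ((\<forall>y. invariant_submanifold A1 B J (\<lambda>x. \<phi> (x, y))) \<and> (\<forall>y. \<theta>2 y \<in> {0..pi / 2}) \<or>
      (\<forall>x. invariant_submanifold A2 B J (\<lambda>y. \<phi> (x, y))) \<and> (\<forall>x. \<theta>1 x \<in> {0..pi / 2}))"

end

theory Submission
  imports Defs
begin

text \<open>Work in charts, and let \<open>\<Phi>\<close> be the immersion in coordinates. Besides the metric \<open>G\<close>, also
\<open>H(v, w) = G(J v, w)\<close> is a symmetric bilinear form that is parallel for the Levi-Civita connection.
For such a form \<open>K\<close>, a vector \<open>x\<close> tangent to the base and \<open>z\<close> tangent to the fiber, the symmetry
\<open>D\<^sub>x \<Phi>\<^sub>z = D\<^sub>z \<Phi>\<^sub>x\<close> of the covariant derivatives of the partial derivatives of \<open>\<Phi>\<close> gives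
\<open>x(K(\<Phi>\<^sub>z, \<Phi>\<^sub>z)) = 2 K(D\<^sub>z \<Phi>\<^sub>x, \<Phi>\<^sub>z) = - 2 K(\<Phi>\<^sub>x, D\<^sub>z \<Phi>\<^sub>z)\<close>
as soon as base and fiber are \<open>K\<close>-orthogonal (lemma \<open>orthogonal_form_derivative\<close>). This holds for
\<open>G\<close> and for \<open>H\<close>. Hence, with \<open>\<alpha> = G(\<Phi>\<^sub>z, \<Phi>\<^sub>z) = f\<^sup>2 |z|\<^sup>2\<close>, \<open>\<beta> = H(\<Phi>\<^sub>z, \<Phi>\<^sub>z)\<close> and the linear form
\<open>\<ell>(v) = - 2 G(v, D\<^sub>z \<Phi>\<^sub>z)\<close>, we have \<open>d\<alpha>(x) = \<ell>(\<Phi>\<^sub>x)\<close> and \<open>d\<beta>(x) = \<ell>(J \<Phi>\<^sub>x)\<close>.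

The slant condition supplies a second relation between \<open>d\<alpha>\<close> and \<open>d\<beta>\<close>. Let \<open>T\<close> be the tangential part
of \<open>J\<close> on the fiber and \<open>c = cos\<^sup>2 \<theta>\<close>. The condition says \<open>|T z|\<^sup>2 = c |J z|\<^sup>2 = c (p \<beta> + q \<alpha>)\<close>, so
Cauchy-Schwarz yields \<open>\<beta>\<^sup>2 \<le> c (p \<beta> + q \<alpha>) \<alpha>\<close> along the base, with equality where \<open>z\<close> is an
eigenvector of \<open>T\<close>. Here \<open>c\<close> is constant along the base because the angle is a function on the fiber.
At a given point choose such an eigenvector (lemma \<open>slant_eigenvector\<close>), with eigenvalue \<open>\<lambda>\<close>; then
\<open>\<lambda>\<^sup>2 = c (p \<lambda> + q)\<close>. The inequality is tight there, and differentiating it gives \<open>d\<beta> = \<lambda> d\<alpha>\<close>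
(lemma \<open>tight_quadratic_derivative\<close>), that is, \<open>\<ell>(J \<Phi>\<^sub>x) = \<lambda> \<ell>(\<Phi>\<^sub>x)\<close> for all \<open>x\<close>.

Finally \<open>J\<close> preserves the tangent space of the invariant base, so this relation can be applied twice:
\<open>\<lambda>\<^sup>2 \<ell>(\<Phi>\<^sub>x) = \<ell>(J\<^sup>2 \<Phi>\<^sub>x) = (p \<lambda> + q) \<ell>(\<Phi>\<^sub>x)\<close>. If \<open>\<ell>(\<Phi>\<^sub>x) \<noteq> 0\<close>, then
\<open>\<lambda>\<^sup>2 = p \<lambda> + q\<close> and \<open>\<lambda>\<^sup>2 = c (p \<lambda> + q)\<close> with \<open>0 < c < 1\<close>, whence \<open>\<lambda> = 0\<close> and \<open>q = 0\<close>, a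
contradiction. So \<open>d(f\<^sup>2) = 0\<close> everywhere (lemmas \<open>warping_derivative_zero\<close> and
\<open>warping_square_derivative\<close>), and \<open>f\<close> is locally constant.\<close>


section \<open>Calculus of smooth maps\<close>

lemma Ck_on_cong:
  assumes "open S" "\<And>x. x \<in> S \<Longrightarrow> f x = g x" "Ck_on k S f"
  shows "Ck_on k S g"
  using assms(2,3)
proof (induction k arbitrary: f g)
  case 0
  then show ?case by (auto cong: continuous_on_cong)
next
  case (Suc k)
  have d: "(g has_derivative frechet_derivative f (at x)) (at x)" if "x \<in> S" for x
    using Suc.prems that assms(1)
    by (auto simp: frechet_derivative_works intro: has_derivative_transform_within_open)
  then have "frechet_derivative f (at x) v = frechet_derivative g (at x) v" if "x \<in> S" for x v
    using frechet_derivative_at that by metis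
  then have "Ck_on k S (\<lambda>x. frechet_derivative g (at x) v)" for v
    using Suc.IH[of "\<lambda>x. frechet_derivative f (at x) v"] Suc.prems by auto
  then show ?case using d by (auto simp: differentiable_def)
qed

text \<open>The recursion of \<open>Ck_on\<close> refers to \<open>frechet_derivative\<close>; this form lets a derivative be supplied by a formula.\<close>

lemma Ck_on_SucI:
  assumes "open S" "\<And>x. x \<in> S \<Longrightarrow> (f has_derivative f' x) (at x)"
    and "\<And>v. Ck_on k S (\<lambda>x. f' x v)"
  shows "Ck_on (Suc k) S f"
proof -
  have "f' x v = frechet_derivative f (at x) v" if "x \<in> S" for x v
    using frechet_derivative_at assms(2) that by metis
  then have "Ck_on k S (\<lambda>x. frechet_derivative f (at x) v)" for v
    using Ck_on_cong[OF assms(1) _ assms(3)[of v]] by auto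
  then show ?thesis using assms(2) by (auto simp: differentiable_def)
qed

lemma Ck_on_SucD:
  assumes "Ck_on (Suc k) S f"
  shows "Ck_on k S f"
  using assms
proof (induction k arbitrary: f)
  case 0
  then show ?case by (auto intro!: continuous_at_imp_continuous_on differentiable_imp_continuous_within)
next
  case (Suc k)
  then show ?case by auto
qed

lemma Ck_on_has_derivative:
  assumes "Ck_on (Suc k) S f" "x \<in> S"
  shows "(f has_derivative frechet_derivative f (at x)) (at x)"
  using assms by (auto simp: frechet_derivative_works)

lemma Ck_on_const: "open S \<Longrightarrow> Ck_on k S (\<lambda>x. c)"
proof (induction k arbitrary: c)
  case (Suc k) then show ?case by (intro Ck_on_SucI[where f' = "\<lambda>x v. 0"]) auto
qed simp

lemma Ck_on_add:
  assumes "open S" "Ck_on k S f" "Ck_on k S g"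
  shows "Ck_on k S (\<lambda>x. f x + g x)"
  using assms(2,3)
proof (induction k arbitrary: f g)
  case 0 then show ?case by (auto intro: continuous_on_add)
next
  case (Suc k)
  show ?case
    by (rule Ck_on_SucI[OF assms(1), where f' = "\<lambda>x v. frechet_derivative f (at x) v + frechet_derivative g (at x) v"])
      (use Suc in \<open>auto intro!: derivative_intros simp: frechet_derivative_works[symmetric]\<close>)
qed

lemma Ck_on_sum:
  assumes "open S" "\<And>i. i \<in> I \<Longrightarrow> Ck_on k S (f i)"
  shows "Ck_on k S (\<lambda>x. \<Sum>i\<in>I. f i x)"
  using assms(2)
  by (induction I rule: infinite_finite_induct) (auto intro: Ck_on_const Ck_on_add assms(1))

lemma Ck_on_linear:
  assumes "open S" "bounded_linear L" "Ck_on k S f"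
  shows "Ck_on k S (\<lambda>x. L (f x))"
  using assms(3)
proof (induction k arbitrary: f)
  case 0 then show ?case
    using continuous_on_compose2[OF linear_continuous_on[OF assms(2), of UNIV]] by auto
next
  case (Suc k)
  show ?case
    by (rule Ck_on_SucI[OF assms(1), where f' = "\<lambda>x v. L (frechet_derivative f (at x) v)"])
     (use Suc in \<open>auto intro!: bounded_linear.has_derivative[OF assms(2)] simp: frechet_derivative_works[symmetric]\<close>)
qed

lemma Ck_on_scaleR:
  fixes f :: "_ \<Rightarrow> real"
  assumes "open S" "Ck_on k S f" "Ck_on k S g"
  shows "Ck_on k S (\<lambda>x. f x *\<^sub>R g x)"
  using assms(2,3)
proof (induction k arbitrary: f g)
  case 0 then show ?case by (auto intro: continuous_on_scaleR)
next
  case (Suc k)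
  have "Ck_on k S f" "Ck_on k S g" using Suc.prems Ck_on_SucD by blast+
  then show ?case
    by (intro Ck_on_SucI[OF assms(1), where f' = "\<lambda>x v. f x *\<^sub>R frechet_derivative g (at x) v + frechet_derivative f (at x) v *\<^sub>R g x"])
      (use Suc in \<open>auto intro!: derivative_intros Ck_on_add assms(1) simp: frechet_derivative_works[symmetric]\<close>)
qed

text \<open>By the chain rule the derivative of \<open>g \<circ> f\<close> along \<open>v\<close> is \<open>Dg\<close> evaluated in the moving direction
\<open>Df(x) v\<close>. Expanding this direction in the standard basis leaves only derivatives of \<open>g\<close> in fixed
directions, to which the induction hypothesis applies.\<close>

lemma Ck_on_compose:
  fixes f :: "'a::real_normed_vector \<Rightarrow> 'b::euclidean_space"
  assumes "open S" "open T" "f ` S \<subseteq> T" "Ck_on k S f" "Ck_on k T g"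
  shows "Ck_on k S (g \<circ> f)"
  using assms(4,5)
proof (induction k arbitrary: g)
  case 0 then show ?case using assms(3)
    by (auto simp: o_def intro: continuous_on_compose2)
next
  case (Suc k)
  have df: "(f has_derivative frechet_derivative f (at x)) (at x)" if "x \<in> S" for x
    using Suc.prems Ck_on_has_derivative that by blast
  have dg: "(g has_derivative frechet_derivative g (at (f x))) (at (f x))" if "x \<in> S" for x
    using Suc.prems Ck_on_has_derivative that assms(3) by blast
  have "frechet_derivative g (at (f x)) (frechet_derivative f (at x) v) =
      (\<Sum>b\<in>Basis. (frechet_derivative f (at x) v \<bullet> b) *\<^sub>R frechet_derivative g (at (f x)) b)"
    if "x \<in> S" for x v
  proof -
    interpret L: linear "frechet_derivative g (at (f x))"
      using dg[OF that] has_derivative_linear by blast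
    show ?thesis
      by (subst (1) euclidean_representation[of "frechet_derivative f (at x) v", symmetric])
        (simp add: L.sum L.scale)
  qed
  then have *: "((g \<circ> f) has_derivative (\<lambda>v. \<Sum>b\<in>Basis.
        (frechet_derivative f (at x) v \<bullet> b) *\<^sub>R frechet_derivative g (at (f x)) b)) (at x)"
    if "x \<in> S" for x
    using diff_chain_at[OF df[OF that] dg[OF that]] that by (simp add: o_def)
  show ?case
  proof (rule Ck_on_SucI[OF assms(1) *])
    fix v
    have "Ck_on k S ((\<lambda>y. frechet_derivative g (at y) b) \<circ> f)" for b
      by (intro Suc.IH Ck_on_SucD[OF Suc.prems(1)]) (use Suc.prems in auto)
    moreover have "Ck_on k S (\<lambda>x. frechet_derivative f (at x) v \<bullet> b)" for b
      using Suc.prems by (intro Ck_on_linear[OF assms(1) bounded_linear_inner_left]) auto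
    ultimately show "Ck_on k S (\<lambda>x. \<Sum>b\<in>Basis.
        (frechet_derivative f (at x) v \<bullet> b) *\<^sub>R frechet_derivative g (at (f x)) b)"
      by (auto simp: o_def intro!: Ck_on_sum Ck_on_scaleR assms(1))
  qed
qed

lemma smooth_on_compose:
  fixes f :: "'a::real_normed_vector \<Rightarrow> 'b::euclidean_space"
  assumes "open S" "open T" "f ` S \<subseteq> T" "smooth_on S f" "smooth_on T g"
  shows "smooth_on S (g \<circ> f)"
  using assms Ck_on_compose unfolding smooth_on_def by blast

lemma smooth_on_cong:
  assumes "open S" "\<And>x. x \<in> S \<Longrightarrow> f x = g x" "smooth_on S f"
  shows "smooth_on S g"
  using assms Ck_on_cong unfolding smooth_on_def by blast

lemma smooth_on_frechet:
  assumes "smooth_on S f"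
  shows "smooth_on S (\<lambda>x. frechet_derivative f (at x) v)"
  using assms unfolding smooth_on_def by (metis Ck_on.simps(2))

lemma smooth_on_has_derivative:
  assumes "smooth_on S f" "x \<in> S"
  shows "(f has_derivative frechet_derivative f (at x)) (at x)"
  using assms Ck_on_has_derivative unfolding smooth_on_def by blast

section \<open>Symmetry of second derivatives\<close>

text \<open>The mean value theorem, used first in the direction \<open>v\<close> and then in the direction \<open>w\<close>, evaluates the
second difference exactly as \<open>t\<^sup>2\<close> times the mixed derivative at a nearby point. As the second
difference is symmetric in \<open>v\<close> and \<open>w\<close>, so is its limit.\<close>

lemma mixed_derivatives_approx:
  fixes F :: "'a::real_normed_vector \<Rightarrow> real"
  assumes S: "open S" "u \<in> S" and F: "Ck_on 2 S F" and e: "e > 0"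
  shows "\<exists>t0>0. \<forall>t. 0 < t \<longrightarrow> t < t0 \<longrightarrow>
     \<bar>F (u + t *\<^sub>R v + t *\<^sub>R w) - F (u + t *\<^sub>R v) - F (u + t *\<^sub>R w) + F u
        - t^2 * frechet_derivative (\<lambda>x. frechet_derivative F (at x) v) (at u) w\<bar> \<le> e * t^2"
proof -
  let ?D = "\<lambda>x. frechet_derivative F (at x) v"
  let ?DD = "\<lambda>x. frechet_derivative ?D (at x) w"
  have F1: "Ck_on (Suc (Suc 0)) S F" using F by (simp add: numeral_2_eq_2)
  have dF: "(F has_derivative frechet_derivative F (at x)) (at x)" if "x \<in> S" for x
    using F1 Ck_on_has_derivative that by blast
  have dD: "(?D has_derivative frechet_derivative ?D (at x)) (at x)" if "x \<in> S" for x
    using F1 that by (auto simp: frechet_derivative_works)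
  have "continuous_on S ?DD" using F1 by auto
  then have "isCont ?DD u" using S continuous_on_eq_continuous_at by blast
  \<comment> \<open>\<open>t0\<close> keeps the parallelogram spanned by \<open>t v\<close> and \<open>t w\<close> where the mixed derivative varies by less than \<open>e\<close>.\<close>
  then obtain r1 where r1: "r1 > 0" "\<And>x. dist x u < r1 \<Longrightarrow> dist (?DD x) (?DD u) < e"
    using e unfolding continuous_at_eps_delta by blast
  obtain r2 where r2: "r2 > 0" "ball u r2 \<subseteq> S" using S open_contains_ball by blast
  define r where "r = min r1 r2"
  have r: "r > 0" using r1 r2 by (auto simp: r_def)
  define t0 where "t0 = r / (norm v + norm w + 1)"
  have n: "norm v + norm w + 1 > 0" by (simp add: add_nonneg_pos)
  have t0: "t0 > 0" using r n by (simp add: t0_def)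
  have inb: "dist (u + a *\<^sub>R v + b *\<^sub>R w) u < r" if "0 \<le> a" "a \<le> t" "0 \<le> b" "b \<le> t" "t < t0" for a b t
  proof -
    have "dist (u + a *\<^sub>R v + b *\<^sub>R w) u = norm (a *\<^sub>R v + b *\<^sub>R w)" by (simp add: dist_norm algebra_simps)
    also have "\<dots> \<le> a * norm v + b * norm w" using that by (intro norm_triangle_le) auto
    also have "\<dots> \<le> t * norm v + t * norm w" using that by (intro add_mono mult_right_mono) auto
    also have "\<dots> \<le> t * (norm v + norm w + 1)" using that by (simp add: algebra_simps)
    also have "\<dots> < r" using that n unfolding t0_def by (simp add: pos_less_divide_eq)
    finally show ?thesis .
  qed
  have inS: "u + a *\<^sub>R v + b *\<^sub>R w \<in> S" if "0 \<le> a" "a \<le> t" "0 \<le> b" "b \<le> t" "t < t0" for a b t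
    using inb[OF that] r2 by (auto simp: r_def dist_commute)
  show ?thesis
  proof (intro exI[of _ t0] conjI t0 allI impI)
    fix t :: real assume t: "0 < t" "t < t0"
    define g where "g s = F (u + s *\<^sub>R v + t *\<^sub>R w) - F (u + s *\<^sub>R v)" for s
    have dg: "DERIV g s :> ?D (u + s *\<^sub>R v + t *\<^sub>R w) - ?D (u + s *\<^sub>R v)" if "0 \<le> s" "s \<le> t" for s
    proof -
      have "((\<lambda>s. F (u + s *\<^sub>R v + b *\<^sub>R w)) has_derivative (\<lambda>h. h * ?D (u + s *\<^sub>R v + b *\<^sub>R w))) (at s)"
        if b: "0 \<le> b" "b \<le> t" for b
      proof -
        have d: "(F has_derivative frechet_derivative F (at (u + s *\<^sub>R v + b *\<^sub>R w))) (at (u + s *\<^sub>R v + b *\<^sub>R w))"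
          using dF inS \<open>0 \<le> s\<close> \<open>s \<le> t\<close> b t by blast
        have "((\<lambda>s. u + s *\<^sub>R v + b *\<^sub>R w) has_derivative (\<lambda>h. h *\<^sub>R v)) (at s)"
          by (auto intro!: derivative_eq_intros)
        from diff_chain_at[OF this d] show ?thesis
          using linear_scale[OF has_derivative_linear[OF d]] by (simp add: o_def)
      qed
      from has_derivative_diff[OF this[of t] this[of 0]] t show ?thesis
        unfolding g_def[abs_def] has_field_derivative_def
        by (auto elim!: back_subst[of "\<lambda>f'. (_ has_derivative f') _"] simp: fun_eq_iff algebra_simps)
    qed
    obtain s where s: "0 < s" "s < t" "g t - g 0 = (t - 0) * (?D (u + s *\<^sub>R v + t *\<^sub>R w) - ?D (u + s *\<^sub>R v))"
      using MVT2[OF t(1) dg] by auto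
    have dk: "DERIV (\<lambda>b. ?D (u + s *\<^sub>R v + b *\<^sub>R w)) b :> ?DD (u + s *\<^sub>R v + b *\<^sub>R w)" if "0 \<le> b" "b \<le> t" for b
    proof -
      have d: "(?D has_derivative frechet_derivative ?D (at (u + s *\<^sub>R v + b *\<^sub>R w))) (at (u + s *\<^sub>R v + b *\<^sub>R w))"
        using s that t by (intro dD inS[of s t b]) auto
      have "((\<lambda>b. u + s *\<^sub>R v + b *\<^sub>R w) has_derivative (\<lambda>h. h *\<^sub>R w)) (at b)"
        by (auto intro!: derivative_eq_intros)
      from diff_chain_at[OF this d] show ?thesis
        using linear_scale[OF has_derivative_linear[OF d]]
        by (simp add: o_def has_field_derivative_def mult_commute_abs)
    qed
    obtain b where b: "0 < b" "b < t"
      "?D (u + s *\<^sub>R v + t *\<^sub>R w) - ?D (u + s *\<^sub>R v + 0 *\<^sub>R w) = (t - 0) * ?DD (u + s *\<^sub>R v + b *\<^sub>R w)"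
      using MVT2[OF t(1) dk] by auto
    have "g t - g 0 = t^2 * ?DD (u + s *\<^sub>R v + b *\<^sub>R w)"
      using s(3) b(3) by (simp add: power2_eq_square)
    then have "\<bar>g t - g 0 - t^2 * ?DD u\<bar> = t^2 * \<bar>?DD (u + s *\<^sub>R v + b *\<^sub>R w) - ?DD u\<bar>"
      by (simp add: abs_mult flip: right_diff_distrib)
    also have "\<dots> \<le> t^2 * e"
    proof (rule mult_left_mono)
      have "dist (?DD (u + s *\<^sub>R v + b *\<^sub>R w)) (?DD u) < e"
        using inb[of s t b] s b t by (intro r1(2)) (auto simp: r_def)
      then show "\<bar>?DD (u + s *\<^sub>R v + b *\<^sub>R w) - ?DD u\<bar> \<le> e" by (simp add: dist_real_def)
    qed simp
    finally show "\<bar>F (u + t *\<^sub>R v + t *\<^sub>R w) - F (u + t *\<^sub>R v) - F (u + t *\<^sub>R w) + F u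
        - t^2 * ?DD u\<bar> \<le> e * t^2"
      by (simp add: g_def algebra_simps)
  qed
qed

lemma mixed_derivatives_real:
  fixes F :: "'a::real_normed_vector \<Rightarrow> real"
  assumes "open S" "u \<in> S" "Ck_on 2 S F"
  shows "frechet_derivative (\<lambda>x. frechet_derivative F (at x) v) (at u) w =
         frechet_derivative (\<lambda>x. frechet_derivative F (at x) w) (at u) v" (is "?a = ?b")
proof (rule ccontr)
  assume ne: "?a \<noteq> ?b"
  define e where "e = \<bar>?a - ?b\<bar> / 3"
  have e: "e > 0" using ne by (simp add: e_def)
  obtain t1 where t1: "t1 > 0" "\<And>t. 0 < t \<Longrightarrow> t < t1 \<Longrightarrow>
     \<bar>F (u + t *\<^sub>R v + t *\<^sub>R w) - F (u + t *\<^sub>R v) - F (u + t *\<^sub>R w) + F u - t^2 * ?a\<bar> \<le> e * t^2"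
    using mixed_derivatives_approx[OF assms e, of v w] by blast
  obtain t2 where t2: "t2 > 0" "\<And>t. 0 < t \<Longrightarrow> t < t2 \<Longrightarrow>
     \<bar>F (u + t *\<^sub>R w + t *\<^sub>R v) - F (u + t *\<^sub>R w) - F (u + t *\<^sub>R v) + F u - t^2 * ?b\<bar> \<le> e * t^2"
    using mixed_derivatives_approx[OF assms e, of w v] by blast
  define t where "t = min t1 t2 / 2"
  have t: "0 < t" "t < t1" "t < t2" using t1(1) t2(1) by (auto simp: t_def)
  have "F (u + t *\<^sub>R w + t *\<^sub>R v) = F (u + t *\<^sub>R v + t *\<^sub>R w)" by (simp add: add_ac)
  then have "\<bar>t^2 * ?a - t^2 * ?b\<bar> \<le> 2 * (e * t^2)"
    using t1(2)[OF t(1,2)] t2(2)[OF t(1,3)] by linarith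
  moreover have "t^2 * ?a - t^2 * ?b = t^2 * (?a - ?b)" by (simp add: right_diff_distrib)
  ultimately have "t^2 * \<bar>?a - ?b\<bar> \<le> t^2 * (2 * e)"
    by (simp add: abs_mult mult_ac)
  then have "\<bar>?a - ?b\<bar> \<le> 2 * e" using t(1) by (simp add: mult_le_cancel_left)
  then show False using e by (simp add: e_def)
qed

lemma mixed_derivatives:
  fixes F :: "'a::real_normed_vector \<Rightarrow> 'b::euclidean_space"
  assumes S: "open S" "u \<in> S" and F: "Ck_on 2 S F"
  shows "frechet_derivative (\<lambda>x. frechet_derivative F (at x) v) (at u) w =
         frechet_derivative (\<lambda>x. frechet_derivative F (at x) w) (at u) v"
proof (rule euclidean_eqI)
  fix b :: 'b assume "b \<in> Basis"
  have F1: "Ck_on (Suc (Suc 0)) S F" using F by (simp add: numeral_2_eq_2)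
  have fd: "frechet_derivative (\<lambda>x. H x \<bullet> b) (at x) = (\<lambda>h. frechet_derivative H (at x) h \<bullet> b)"
    if "H differentiable (at x)" for H :: "'a \<Rightarrow> 'b" and x
    using that by (intro frechet_derivative_at[symmetric] has_derivative_inner_left)
      (simp add: frechet_derivative_works)
  have *: "frechet_derivative (\<lambda>x. frechet_derivative (\<lambda>x. F x \<bullet> b) (at x) v) (at u) w =
     frechet_derivative (\<lambda>x. frechet_derivative F (at x) v) (at u) w \<bullet> b" for v w
  proof -
    have "((\<lambda>x. frechet_derivative F (at x) v \<bullet> b) has_derivative
        (\<lambda>h. frechet_derivative (\<lambda>x. frechet_derivative F (at x) v) (at u) h \<bullet> b)) (at u)"
      using F1 S(2) by (auto intro!: has_derivative_inner_left simp flip: frechet_derivative_works)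
    then have "((\<lambda>x. frechet_derivative (\<lambda>x. F x \<bullet> b) (at x) v) has_derivative
        (\<lambda>h. frechet_derivative (\<lambda>x. frechet_derivative F (at x) v) (at u) h \<bullet> b)) (at u)"
      by (rule has_derivative_transform_within_open[OF _ S]) (use F1 fd in auto)
    then show ?thesis by (metis frechet_derivative_at)
  qed
  show "frechet_derivative (\<lambda>x. frechet_derivative F (at x) v) (at u) w \<bullet> b =
        frechet_derivative (\<lambda>x. frechet_derivative F (at x) w) (at u) v \<bullet> b"
    using mixed_derivatives_real[OF S Ck_on_linear[OF S(1) bounded_linear_inner_left F]] *
    by metis
qed

section \<open>Tangent vectors in coordinates\<close>

text \<open>Coordinate formulas for tangent vectors and differentials only need differentiable chart changes. For a
product atlas this is easier to establish than smoothness.\<close>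

definition diff_atlas :: "('m::topological_space, 'a::euclidean_space) chart set \<Rightarrow> bool" where
  "diff_atlas A \<longleftrightarrow> (\<forall>c\<in>A. is_chart c) \<and> (\<Union>c\<in>A. cdom c) = UNIV \<and>
     (\<forall>c\<in>A. \<forall>d\<in>A. \<forall>p\<in>cdom c \<inter> cdom d. (cmap d \<circ> cinv c) differentiable (at (cmap c p)))"

text \<open>The tangent vector at \<open>p\<close> with coordinate vector \<open>v\<close> in the chart \<open>c\<close>. For fixed \<open>v\<close> this is a
coordinate vector field on the domain of \<open>c\<close>.\<close>

definition coord_vec :: "('m, 'a::euclidean_space) chart set \<Rightarrow> ('m, 'a) chart \<Rightarrow> 'm \<Rightarrow> 'a \<Rightarrow> ('m, 'a) tvec" where
  "coord_vec A c p v = (\<lambda>d. if d \<in> A \<and> p \<in> cdom d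
     then frechet_derivative (cmap d \<circ> cinv c) (at (cmap c p)) v else 0)"

lemma chart_inverse:
  assumes "is_chart c"
  shows "p \<in> cdom c \<Longrightarrow> cinv c (cmap c p) = p"
    and "u \<in> cmap c ` cdom c \<Longrightarrow> cinv c u \<in> cdom c"
    and "u \<in> cmap c ` cdom c \<Longrightarrow> cmap c (cinv c u) = u"
  using assms by (auto simp: is_chart_def homeomorphism_def)

lemma chart_open_image:
  assumes "is_chart c" "open U"
  shows "open (cmap c ` (cdom c \<inter> U))"
proof -
  have "openin (top_of_set (cdom c)) (cdom c \<inter> U)"
    using assms by auto
  then have "openin (top_of_set (cmap c ` cdom c)) (cmap c ` (cdom c \<inter> U))"
    using assms(1) homeomorphism_imp_open_map unfolding is_chart_def by blast
  then show ?thesis using assms(1) unfolding is_chart_def by (meson openin_open_trans)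
qed

lemma diff_atlasD:
  assumes "diff_atlas A" "c \<in> A"
  shows "is_chart c"
    and "d \<in> A \<Longrightarrow> p \<in> cdom c \<Longrightarrow> p \<in> cdom d \<Longrightarrow> (cmap d \<circ> cinv c has_derivative
           frechet_derivative (cmap d \<circ> cinv c) (at (cmap c p))) (at (cmap c p))"
  using assms unfolding diff_atlas_def frechet_derivative_works[symmetric] by blast+

lemma chart_at_in:
  assumes "diff_atlas A"
  shows "chart_at A p \<in> A" "p \<in> cdom (chart_at A p)"
proof -
  have "\<exists>c. c \<in> A \<and> p \<in> cdom c" using assms unfolding diff_atlas_def by blast
  from someI_ex[OF this] show "chart_at A p \<in> A" "p \<in> cdom (chart_at A p)"
    by (auto simp: chart_at_def)
qed

lemma smooth_transition:
  assumes "smooth_manifold A" "c \<in> A" "d \<in> A"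
  shows "smooth_on (cmap c ` (cdom c \<inter> cdom d)) (cmap d \<circ> cinv c)"
  using assms by (auto simp: smooth_manifold_def)

lemma smooth_manifold_diff_atlas:
  assumes "smooth_manifold A"
  shows "diff_atlas A"
  unfolding diff_atlas_def
proof (intro conjI ballI)
  fix c d p assume "c \<in> A" "d \<in> A" "p \<in> cdom c \<inter> cdom d"
  then show "(cmap d \<circ> cinv c) differentiable (at (cmap c p))"
    using smooth_on_has_derivative[OF smooth_transition[OF assms]] differentiable_def by blast
qed (use assms in \<open>auto simp: smooth_manifold_def\<close>)

text \<open>Derivatives in two charts differ by the derivative of the chart change. All independence of the
charts chosen by \<open>chart_at\<close> rests on this.\<close>

lemma has_derivative_change_chart:
  assumes A: "diff_atlas A" "c \<in> A" "d \<in> A" "p \<in> cdom c" "p \<in> cdom d"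
    and L: "(f \<circ> cinv d has_derivative L) (at (cmap d p))"
  shows "(f \<circ> cinv c has_derivative (L \<circ> frechet_derivative (cmap d \<circ> cinv c) (at (cmap c p)))) (at (cmap c p))"
proof (rule has_derivative_transform_within_open)
  have c: "is_chart c" and d: "is_chart d" using A diff_atlasD by blast+
  have "(f \<circ> cinv d has_derivative L) (at ((cmap d \<circ> cinv c) (cmap c p)))"
    using L chart_inverse[OF c] A by simp
  from diff_chain_at[OF diff_atlasD(2)[OF A] this]
  show "((f \<circ> cinv d) \<circ> (cmap d \<circ> cinv c) has_derivative
     (L \<circ> frechet_derivative (cmap d \<circ> cinv c) (at (cmap c p)))) (at (cmap c p))" .
  show "open (cmap c ` (cdom c \<inter> cdom d))"
    using chart_open_image[OF c] d by (auto simp: is_chart_def)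
  show "cmap c p \<in> cmap c ` (cdom c \<inter> cdom d)" using A by auto
  show "(f \<circ> cinv d \<circ> (cmap d \<circ> cinv c)) u = (f \<circ> cinv c) u"
    if "u \<in> cmap c ` (cdom c \<inter> cdom d)" for u
    using that chart_inverse[OF c] chart_inverse[OF d] by auto
qed

text \<open>The compatibility of the coordinates of a tangent vector in three charts.\<close>

lemma frechet_cocycle:
  assumes A: "diff_atlas A" "c \<in> A" "d \<in> A" "e \<in> A" "p \<in> cdom c" "p \<in> cdom d" "p \<in> cdom e"
  shows "frechet_derivative (cmap e \<circ> cinv c) (at (cmap c p)) v =
    frechet_derivative (cmap e \<circ> cinv d) (at (cmap d p)) (frechet_derivative (cmap d \<circ> cinv c) (at (cmap c p)) v)"
  using fun_cong[OF frechet_derivative_at[OF has_derivative_change_chart[OF A(1,2,3,5,6) diff_atlasD(2)[OF A(1,3,4,6,7)]]], of v]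
  by (simp only: o_apply)

lemma frechet_chart_self:
  assumes A: "diff_atlas A" "c \<in> A" "p \<in> cdom c"
  shows "frechet_derivative (cmap c \<circ> cinv c) (at (cmap c p)) v = v"
proof -
  have c: "is_chart c" using A diff_atlasD by blast
  have "(cmap c \<circ> cinv c has_derivative (\<lambda>v. v)) (at (cmap c p))"
  proof (rule has_derivative_transform_within_open[OF has_derivative_ident])
    show "open (cmap c ` cdom c)" "cmap c p \<in> cmap c ` cdom c"
      using A c by (auto simp: is_chart_def)
    show "u = (cmap c \<circ> cinv c) u" if "u \<in> cmap c ` cdom c" for u
      using that chart_inverse[OF c] by auto
  qed
  then show ?thesis using frechet_derivative_at by metis
qed

lemma coord_vec_same:
  assumes "diff_atlas A" "c \<in> A" "p \<in> cdom c"
  shows "coord_vec A c p v c = v"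
  using assms frechet_chart_self[OF assms] by (simp add: coord_vec_def)

lemma coord_vec_tangent:
  assumes "diff_atlas A" "c \<in> A" "p \<in> cdom c"
  shows "coord_vec A c p v \<in> tangent_space A p"
  using assms unfolding tangent_space_def coord_vec_def
  by (auto intro!: frechet_cocycle)

lemma tangent_eq_coord_vec:
  assumes "c \<in> A" "p \<in> cdom c" "X \<in> tangent_space A p"
  shows "X = coord_vec A c p (X c)"
proof
  fix d
  show "X d = coord_vec A c p (X c) d"
  proof (cases "d \<in> A \<and> p \<in> cdom d")
    case True
    then have "X d = frechet_derivative (cmap d \<circ> cinv c) (at (cmap c p)) (X c)"
      using assms unfolding tangent_space_def by blast
    then show ?thesis using True unfolding coord_vec_def by (simp only: if_True simp_thms)
  next
    case False
    then have "X d = 0" using assms(3) unfolding tangent_space_def by blast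
    then show ?thesis using False unfolding coord_vec_def by (simp only: if_False)
  qed
qed

lemma tangent_space_eq_range:
  assumes "diff_atlas A" "c \<in> A" "p \<in> cdom c"
  shows "tangent_space A p = range (coord_vec A c p)"
  using coord_vec_tangent[OF assms] tangent_eq_coord_vec[OF assms(2,3)] by (auto intro: range_eqI)

lemma coord_vec_scale_add:
  assumes "diff_atlas A" "c \<in> A" "p \<in> cdom c"
  shows "coord_vec A c p (r *\<^sub>R v + w) = r *\<^sub>R coord_vec A c p v + coord_vec A c p w"
proof
  fix d
  show "coord_vec A c p (r *\<^sub>R v + w) d = (r *\<^sub>R coord_vec A c p v + coord_vec A c p w) d"
  proof (cases "d \<in> A \<and> p \<in> cdom d")
    case True
    then interpret linear "frechet_derivative (cmap d \<circ> cinv c) (at (cmap c p))"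
      using diff_atlasD(2)[OF assms(1,2)] assms(3) has_derivative_linear by blast
    show ?thesis using True by (simp add: coord_vec_def scaleR_fun_def add scale)
  qed (auto simp: coord_vec_def scaleR_fun_def)
qed

lemma coord_vec_0:
  assumes "diff_atlas A" "c \<in> A" "p \<in> cdom c"
  shows "coord_vec A c p 0 = 0"
  using coord_vec_scale_add[OF assms, of "-1" 0 0] by simp

lemma coord_vec_eq_0_iff:
  assumes "diff_atlas A" "c \<in> A" "p \<in> cdom c"
  shows "coord_vec A c p v = 0 \<longleftrightarrow> v = 0"
  using coord_vec_same[OF assms, of v] coord_vec_0[OF assms] by (metis zero_fun_apply)

lemma coord_vec_chart_back:
  assumes "diff_atlas A" "c \<in> A" "p \<in> cdom c" "e \<in> A" "p \<in> cdom e"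
  shows "frechet_derivative (cmap c \<circ> cinv e) (at (cmap e p)) (coord_vec A c p v e) = v"
  using frechet_cocycle[of A c e c p v] frechet_chart_self[of A c p v] assms
  by (simp add: coord_vec_def)

lemma dir_deriv_coord_vec:
  assumes A: "diff_atlas A" "c \<in> A" "p \<in> cdom c"
    and L: "(h \<circ> cinv c has_derivative L) (at (cmap c p))"
  shows "dir_deriv A p (coord_vec A c p v) h = L v"
proof -
  let ?e = "chart_at A p"
  have e: "?e \<in> A" "p \<in> cdom ?e" using chart_at_in[OF A(1)] by auto
  have "frechet_derivative (h \<circ> cinv ?e) (at (cmap ?e p)) = L \<circ> frechet_derivative (cmap c \<circ> cinv ?e) (at (cmap ?e p))"
    using has_derivative_change_chart[OF A(1) e(1) A(2) e(2) A(3) L] frechet_derivative_at by metis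
  then show ?thesis using coord_vec_chart_back[OF A e] by (simp add: dir_deriv_def)
qed

text \<open>The definition of \<open>differential\<close> computes in the chart picked by \<open>chart_at\<close>; by the chart change formula any pair
of charts around \<open>p\<close> and \<open>F p\<close> may be used instead.\<close>

lemma differential_coord_vec:
  assumes A: "diff_atlas A" "c \<in> A" "p \<in> cdom c" and B: "diff_atlas B" "d \<in> B" "F p \<in> cdom d"
    and F: "continuous_on UNIV F"
    and L: "(cmap d \<circ> F \<circ> cinv c has_derivative L) (at (cmap c p))"
  shows "differential A B F p (coord_vec A c p v) = coord_vec B d (F p) (L v)"
proof
  fix d'
  let ?e = "chart_at A p"
  have e: "?e \<in> A" "p \<in> cdom ?e" using chart_at_in[OF A(1)] by auto
  have c: "is_chart c" and d: "is_chart d" using A B diff_atlasD by blast+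
  show "differential A B F p (coord_vec A c p v) d' = coord_vec B d (F p) (L v) d'"
  proof (cases "d' \<in> B \<and> F p \<in> cdom d'")
    case True
    have "((cmap d' \<circ> F) \<circ> cinv c has_derivative
        (frechet_derivative (cmap d' \<circ> cinv d) (at (cmap d (F p))) \<circ> L)) (at (cmap c p))"
    proof (rule has_derivative_transform_within_open)
      have "(cmap d' \<circ> cinv d has_derivative frechet_derivative (cmap d' \<circ> cinv d) (at (cmap d (F p))))
         (at ((cmap d \<circ> F \<circ> cinv c) (cmap c p)))"
        using diff_atlasD(2)[OF B(1,2), of d' "F p"] B True chart_inverse[OF c] A by simp
      from diff_chain_at[OF L this]
      show "((cmap d' \<circ> cinv d) \<circ> (cmap d \<circ> F \<circ> cinv c) has_derivative
          (frechet_derivative (cmap d' \<circ> cinv d) (at (cmap d (F p))) \<circ> L)) (at (cmap c p))" .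
      have "open (F -` cdom d)"
        using F d by (auto simp: is_chart_def intro: open_vimage)
      then show "open (cmap c ` (cdom c \<inter> F -` cdom d))"
        by (rule chart_open_image[OF c])
      show "cmap c p \<in> cmap c ` (cdom c \<inter> F -` cdom d)" using A B by auto
      show "((cmap d' \<circ> cinv d) \<circ> (cmap d \<circ> F \<circ> cinv c)) u = ((cmap d' \<circ> F) \<circ> cinv c) u"
        if "u \<in> cmap c ` (cdom c \<inter> F -` cdom d)" for u
        using that chart_inverse[OF c] chart_inverse[OF d] by auto
    qed
    from has_derivative_change_chart[OF A(1) e(1) A(2) e(2) A(3) this]
    have "frechet_derivative (cmap d' \<circ> F \<circ> cinv ?e) (at (cmap ?e p)) (coord_vec A c p v ?e) =
      frechet_derivative (cmap d' \<circ> cinv d) (at (cmap d (F p))) (L v)"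
      using coord_vec_chart_back[OF A e] frechet_derivative_at by (metis comp_apply)
    then show ?thesis using True by (simp add: differential_def coord_vec_def)
  qed (auto simp: differential_def coord_vec_def)
qed

text \<open>In another chart \<open>d\<close> the field is the derivative of the chart change along \<open>v\<close>, composed with the
inverse chart change; both are smooth.\<close>

lemma coord_vec_smooth:
  assumes A: "smooth_manifold A" "c \<in> A"
  shows "smooth_vector_field A (cdom c) (\<lambda>p. coord_vec A c p v)"
  unfolding smooth_vector_field_def
proof (intro conjI ballI)
  note dA = smooth_manifold_diff_atlas[OF A(1)]
  show "coord_vec A c p v \<in> tangent_space A p" if "p \<in> cdom c" for p
    using coord_vec_tangent dA A(2) that by blast
  fix d assume d: "d \<in> A"
  have ic: "is_chart c" and id: "is_chart d" using d A dA diff_atlasD by blast+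
  have o1: "open (cmap d ` (cdom c \<inter> cdom d))" and o2: "open (cmap c ` (cdom c \<inter> cdom d))"
    using chart_open_image[OF ic, of "cdom d"] chart_open_image[OF id, of "cdom c"] ic id
    by (auto simp: is_chart_def Int_commute)
  have "smooth_on (cmap d ` (cdom c \<inter> cdom d))
     ((\<lambda>u. frechet_derivative (cmap d \<circ> cinv c) (at u) v) \<circ> (cmap c \<circ> cinv d))"
  proof (rule smooth_on_compose[OF o1 o2])
    show "(cmap c \<circ> cinv d) ` cmap d ` (cdom c \<inter> cdom d) \<subseteq> cmap c ` (cdom c \<inter> cdom d)"
      using chart_inverse[OF id] by auto
    show "smooth_on (cmap d ` (cdom c \<inter> cdom d)) (cmap c \<circ> cinv d)"
      using smooth_transition[OF A(1) d A(2)] by (simp add: Int_commute)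
    show "smooth_on (cmap c ` (cdom c \<inter> cdom d)) (\<lambda>u. frechet_derivative (cmap d \<circ> cinv c) (at u) v)"
      using smooth_on_frechet smooth_transition[OF A d] by blast
  qed
  then show "smooth_on (cmap d ` (cdom c \<inter> cdom d)) (\<lambda>u. coord_vec A c (cinv d u) v d)"
    by (rule smooth_on_cong[OF o1, rotated]) (use chart_inverse[OF id] d in \<open>auto simp: coord_vec_def\<close>)
qed

lemma coordinate_smooth:
  assumes A: "smooth_manifold A" "c \<in> A"
  shows "smooth_fun A (cdom c) (\<lambda>p. cmap c p \<bullet> b)"
  unfolding smooth_fun_def
proof
  fix d assume d: "d \<in> A"
  note dA = smooth_manifold_diff_atlas[OF A(1)]
  have ic: "is_chart c" and id: "is_chart d" using d A dA diff_atlasD by blast+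
  have o1: "open (cmap d ` (cdom c \<inter> cdom d))"
    using chart_open_image[OF id, of "cdom c"] ic by (auto simp: is_chart_def Int_commute)
  have "smooth_on (cmap d ` (cdom c \<inter> cdom d)) (\<lambda>u. (cmap c \<circ> cinv d) u \<bullet> b)"
    using smooth_transition[OF A(1) d A(2)] unfolding smooth_on_def
    by (intro allI Ck_on_linear[OF o1 bounded_linear_inner_left]) (simp add: Int_commute del: o_apply)
  then show "smooth_on (cmap d ` (cdom c \<inter> cdom d)) ((\<lambda>p. cmap c p \<bullet> b) \<circ> cinv d)"
    by (simp add: o_def)
qed

section \<open>Product charts\<close>

abbreviation chart_prod :: "('m, 'a) chart \<Rightarrow> ('n, 'b) chart \<Rightarrow> ('m \<times> 'n, 'a \<times> 'b) chart" where
  "chart_prod c d \<equiv> (cdom c \<times> cdom d, map_prod (cmap c) (cmap d))"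

lemma prod_chart:
  assumes c: "is_chart c" and d: "is_chart d"
  shows "is_chart (chart_prod c d)"
    and "x \<in> cdom c \<Longrightarrow> y \<in> cdom d \<Longrightarrow>
      cinv (chart_prod c d) (cmap c x, cmap d y) = (x, y)"
proof -
  let ?e = "chart_prod c d"
  have inj: "inj_on (cmap c) (cdom c)" "inj_on (cmap d) (cdom d)"
    using chart_inverse(1)[OF c] chart_inverse(1)[OF d] by (metis inj_onI)+
  have ie: "inj_on (map_prod (cmap c) (cmap d)) (cdom c \<times> cdom d)"
    using inj by (rule map_prod_inj_on)
  have inv: "cinv ?e (cmap c x, cmap d y) = (x, y)" if "x \<in> cdom c" "y \<in> cdom d" for x y
    using inv_into_f_f[OF ie, of "(x, y)"] that by simp
  then show "x \<in> cdom c \<Longrightarrow> y \<in> cdom d \<Longrightarrow> cinv ?e (cmap c x, cmap d y) = (x, y)" .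
  have im: "map_prod (cmap c) (cmap d) ` (cdom c \<times> cdom d) = (cmap c ` cdom c) \<times> (cmap d ` cdom d)"
    by (rule map_prod_surj_on) auto
  have hc: "continuous_on (cdom c) (cmap c)" "continuous_on (cmap c ` cdom c) (cinv c)"
    and hd: "continuous_on (cdom d) (cmap d)" "continuous_on (cmap d ` cdom d) (cinv d)"
    using c d by (auto simp: is_chart_def homeomorphism_def)
  have 1: "continuous_on (cdom c \<times> cdom d) (map_prod (cmap c) (cmap d))"
    unfolding map_prod_def case_prod_unfold
    by (intro continuous_on_Pair continuous_on_compose2[OF hc(1)] continuous_on_compose2[OF hd(1)]
        continuous_intros) auto
  have "continuous_on ((cmap c ` cdom c) \<times> (cmap d ` cdom d)) (\<lambda>u. (cinv c (fst u), cinv d (snd u)))"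
    by (intro continuous_on_Pair continuous_on_compose2[OF hc(2)] continuous_on_compose2[OF hd(2)]
        continuous_intros) auto
  then have 2: "continuous_on ((cmap c ` cdom c) \<times> (cmap d ` cdom d)) (cinv ?e)"
    by (rule continuous_on_eq) (use inv chart_inverse[OF c] chart_inverse[OF d] in auto)
  have "cinv ?e ` map_prod (cmap c) (cmap d) ` (cdom c \<times> cdom d) = cdom c \<times> cdom d"
    using inv_into_image_cancel[OF ie] by simp
  then show "is_chart ?e"
    using c d 1 2 inv im unfolding is_chart_def homeomorphism_def fst_conv snd_conv
    by (auto intro!: open_Times)
qed

lemma chart_prod_inverse:
  assumes "is_chart c" "is_chart d" "u \<in> cmap c ` cdom c \<times> cmap d ` cdom d"
  shows "cinv (chart_prod c d) u = (cinv c (fst u), cinv d (snd u))"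
proof -
  obtain x y where u: "u = (cmap c x, cmap d y)" "x \<in> cdom c" "y \<in> cdom d"
    using assms(3) by (cases u) blast
  show ?thesis
    using prod_chart(2)[OF assms(1,2) u(2,3)] chart_inverse(1)[OF assms(1) u(2)] chart_inverse(1)[OF assms(2) u(3)]
    by (simp add: u(1))
qed

lemma prod_atlasE:
  assumes "c \<in> prod_atlas A B"
  obtains c1 c2 where "c = chart_prod c1 c2" "c1 \<in> A" "c2 \<in> B"
proof -
  from assms obtain q where
    "c = (case q of (c, d) \<Rightarrow> chart_prod c d)" "q \<in> A \<times> B"
    unfolding prod_atlas_def by (rule imageE)
  then show thesis using that[of "fst q" "snd q"] by (simp add: case_prod_beta mem_Times_iff)
qed

lemma prod_atlasI:
  assumes "c \<in> A" "d \<in> B"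
  shows "chart_prod c d \<in> prod_atlas A B"
  unfolding prod_atlas_def using assms by (intro image_eqI[of _ _ "(c, d)"]) auto

lemma prod_atlas_diff_atlas:
  assumes A: "diff_atlas A" and B: "diff_atlas B"
  shows "diff_atlas (prod_atlas A B)"
  unfolding diff_atlas_def
proof (intro conjI ballI)
  fix c assume "c \<in> prod_atlas A B"
  then obtain c1 c2 where "c = chart_prod c1 c2" "c1 \<in> A" "c2 \<in> B"
    by (rule prod_atlasE)
  then show "is_chart c"
    by (metis prod_chart(1) diff_atlasD(1) A B)
next
  show "(\<Union>c\<in>prod_atlas A B. cdom c) = UNIV"
  proof (intro equalityI subset_UNIV subsetI)
    fix p :: "'a \<times> 'c"
    have "p \<in> cdom (chart_at A (fst p)) \<times> cdom (chart_at B (snd p))"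
      using chart_at_in(2)[OF A] chart_at_in(2)[OF B] by (simp add: mem_Times_iff)
    then show "p \<in> (\<Union>c\<in>prod_atlas A B. cdom c)"
      using prod_atlasI[OF chart_at_in(1)[OF A] chart_at_in(1)[OF B]] by (metis UN_I fst_conv)
  qed
next
  fix c d p assume "c \<in> prod_atlas A B" "d \<in> prod_atlas A B" "p \<in> cdom c \<inter> cdom d"
  then obtain c1 c2 d1 d2 where
    c: "c = chart_prod c1 c2" "c1 \<in> A" "c2 \<in> B" and
    d: "d = chart_prod d1 d2" "d1 \<in> A" "d2 \<in> B"
    by (metis prod_atlasE)
  obtain x y where p: "p = (x, y)" "x \<in> cdom c1" "x \<in> cdom d1" "y \<in> cdom c2" "y \<in> cdom d2"
    using \<open>p \<in> cdom c \<inter> cdom d\<close> c(1) d(1) by (cases p) simp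
  have i: "is_chart c1" "is_chart c2" "is_chart d1" "is_chart d2"
    using c d diff_atlasD(1)[OF A] diff_atlasD(1)[OF B] by auto
  note h1 = diff_atlasD(2)[OF A c(2) d(2) p(2,3)] and h2 = diff_atlasD(2)[OF B c(3) d(3) p(4,5)]
  have "((cmap d1 \<circ> cinv c1) \<circ> fst has_derivative
      frechet_derivative (cmap d1 \<circ> cinv c1) (at (cmap c1 x)) \<circ> fst) (at (cmap c1 x, cmap c2 y))"
    by (rule diff_chain_at[OF bounded_linear_imp_has_derivative[OF bounded_linear_fst]]) (simp add: h1)
  moreover have "((cmap d2 \<circ> cinv c2) \<circ> snd has_derivative
      frechet_derivative (cmap d2 \<circ> cinv c2) (at (cmap c2 y)) \<circ> snd) (at (cmap c1 x, cmap c2 y))"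
    by (rule diff_chain_at[OF bounded_linear_imp_has_derivative[OF bounded_linear_snd]]) (simp add: h2)
  ultimately have pr: "((\<lambda>u. (((cmap d1 \<circ> cinv c1) \<circ> fst) u, ((cmap d2 \<circ> cinv c2) \<circ> snd) u)) has_derivative
     (\<lambda>h. ((frechet_derivative (cmap d1 \<circ> cinv c1) (at (cmap c1 x)) \<circ> fst) h,
           (frechet_derivative (cmap d2 \<circ> cinv c2) (at (cmap c2 y)) \<circ> snd) h))) (at (cmap c1 x, cmap c2 y))"
    by (rule has_derivative_Pair)
  have "(cmap d \<circ> cinv c has_derivative
     (\<lambda>h. ((frechet_derivative (cmap d1 \<circ> cinv c1) (at (cmap c1 x)) \<circ> fst) h,
           (frechet_derivative (cmap d2 \<circ> cinv c2) (at (cmap c2 y)) \<circ> snd) h))) (at (cmap c1 x, cmap c2 y))"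
  proof (rule has_derivative_transform_within_open[OF pr])
    show "open ((cmap c1 ` cdom c1) \<times> (cmap c2 ` cdom c2))"
      using i unfolding is_chart_def by (intro open_Times) blast+
    show "(cmap c1 x, cmap c2 y) \<in> (cmap c1 ` cdom c1) \<times> (cmap c2 ` cdom c2)" using p by auto
    show "(((cmap d1 \<circ> cinv c1) \<circ> fst) u, ((cmap d2 \<circ> cinv c2) \<circ> snd) u) = (cmap d \<circ> cinv c) u"
      if u0: "u \<in> (cmap c1 ` cdom c1) \<times> (cmap c2 ` cdom c2)" for u
    proof -
      obtain x' y' where u: "u = (cmap c1 x', cmap c2 y')" "x' \<in> cdom c1" "y' \<in> cdom c2"
        using u0 by (cases u) blast
      show ?thesis
        using prod_chart(2)[OF i(1,2) u(2,3)] chart_inverse(1)[OF i(1) u(2)] chart_inverse(1)[OF i(2) u(3)]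
        by (simp add: c(1) d(1) u(1))
    qed
  qed
  then show "(cmap d \<circ> cinv c) differentiable (at (cmap c p))"
    using c(1) p(1) by (auto simp: differentiable_def)
qed

section \<open>Parallel bilinear forms along a map\<close>

lemma linear_scale_addI:
  assumes "\<And>r x y. f (r *\<^sub>R x + y) = r *\<^sub>R f x + f y"
  shows "linear f"
proof -
  have "f 0 = 0" using assms[of 1 0 0] by simp
  then show ?thesis using assms[of 1] assms[of _ _ 0] by (intro linearI) simp_all
qed

text \<open>Reduces the derivative of a form with moving arguments to derivatives of its values on basis vectors.\<close>

lemma bilinear_expand:
  fixes b :: "'a::euclidean_space \<Rightarrow> 'b::euclidean_space \<Rightarrow> real"
  assumes "bilinear b"
  shows "b v w = (\<Sum>i\<in>Basis. \<Sum>j\<in>Basis. (v \<bullet> i) * (w \<bullet> j) * b i j)"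
proof -
  have "b v w = b (\<Sum>i\<in>Basis. (v \<bullet> i) *\<^sub>R i) (\<Sum>j\<in>Basis. (w \<bullet> j) *\<^sub>R j)"
    by (simp only: euclidean_representation)
  also have "\<dots> = (\<Sum>(i, j)\<in>Basis \<times> Basis. b ((v \<bullet> i) *\<^sub>R i) ((w \<bullet> j) *\<^sub>R j))"
    by (rule bilinear_sum[OF assms])
  also have "\<dots> = (\<Sum>i\<in>Basis. \<Sum>j\<in>Basis. (v \<bullet> i) * (w \<bullet> j) * b i j)"
    by (simp add: sum.cartesian_product bilinear_lmul[OF assms] bilinear_rmul[OF assms] mult_ac)
  finally show ?thesis .
qed

text \<open>\<open>\<Gamma> u\<close> plays the role of the Christoffel symbols at the point with coordinates \<open>u\<close>, and the
derivative condition is \<open>\<nabla>K = 0\<close> evaluated on constant fields.\<close>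

definition parallel_form :: "'c::euclidean_space set \<Rightarrow> ('c \<Rightarrow> 'c \<Rightarrow> 'c \<Rightarrow> 'c) \<Rightarrow> ('c \<Rightarrow> 'c \<Rightarrow> 'c \<Rightarrow> real) \<Rightarrow> bool" where
  "parallel_form S \<Gamma> K \<longleftrightarrow> (\<forall>u\<in>S. bilinear (K u) \<and> (\<forall>v w. K u v w = K u w v) \<and>
     (\<forall>v w. ((\<lambda>u. K u v w) has_derivative (\<lambda>h. K u (\<Gamma> u h v) w + K u v (\<Gamma> u h w))) (at u)))"

text \<open>Symmetry of \<open>\<Gamma> u\<close> is torsion-freeness.\<close>

definition christoffel :: "'c::euclidean_space set \<Rightarrow> ('c \<Rightarrow> 'c \<Rightarrow> 'c \<Rightarrow> 'c) \<Rightarrow> bool" where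
  "christoffel S \<Gamma> \<longleftrightarrow> (\<forall>u\<in>S. bilinear (\<Gamma> u) \<and> (\<forall>v w. \<Gamma> u v w = \<Gamma> u w v))"

text \<open>The product rule for fields \<open>V\<close> and \<open>W\<close> along the map \<open>\<Phi>\<close>. Parallelism is assumed for constant fields
only, so the arguments are first expanded in the standard basis.\<close>

lemma parallel_form_has_derivative:
  fixes \<Phi> V W :: "'e::real_normed_vector \<Rightarrow> 'c::euclidean_space"
  assumes S: "open S" and \<Gamma>: "christoffel S \<Gamma>" and K: "parallel_form S \<Gamma> K" and t: "\<Phi> t \<in> S"
    and \<Phi>: "(\<Phi> has_derivative \<Phi>') (at t)"
    and V: "(V has_derivative V') (at t)" and W: "(W has_derivative W') (at t)"
  shows "((\<lambda>t. K (\<Phi> t) (V t) (W t)) has_derivative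
     (\<lambda>h. K (\<Phi> t) (V' h + \<Gamma> (\<Phi> t) (\<Phi>' h) (V t)) (W t) + K (\<Phi> t) (V t) (W' h + \<Gamma> (\<Phi> t) (\<Phi>' h) (W t)))) (at t)"
proof -
  have bil: "bilinear (K u)" if "u \<in> S" for u using K that by (auto simp: parallel_form_def)
  note b = bil[OF t]
  have lK1: "linear (\<lambda>x. K (\<Phi> t) x y)" and lK2: "linear (K (\<Phi> t) y)" for y
    using b by (auto simp: bilinear_def)
  have l\<Gamma>: "linear (\<Gamma> (\<Phi> t) h)" for h
    using \<Gamma> t by (auto simp: christoffel_def bilinear_def)
  let ?E = "\<lambda>t. \<Sum>i\<in>Basis. \<Sum>j\<in>Basis. (V t \<bullet> i) * (W t \<bullet> j) * K (\<Phi> t) i j"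
  have dK: "((\<lambda>t. K (\<Phi> t) i j) has_derivative
       (\<lambda>h. K (\<Phi> t) (\<Gamma> (\<Phi> t) (\<Phi>' h) i) j + K (\<Phi> t) i (\<Gamma> (\<Phi> t) (\<Phi>' h) j))) (at t)" for i j
  proof -
    have "((\<lambda>u. K u i j) has_derivative (\<lambda>h. K (\<Phi> t) (\<Gamma> (\<Phi> t) h i) j + K (\<Phi> t) i (\<Gamma> (\<Phi> t) h j))) (at (\<Phi> t))"
      using K t by (auto simp: parallel_form_def)
    from diff_chain_at[OF \<Phi> this] show ?thesis by (simp add: o_def)
  qed
  have "(?E has_derivative (\<lambda>h. \<Sum>i\<in>Basis. \<Sum>j\<in>Basis.
      (V t \<bullet> i) * (W t \<bullet> j) * (K (\<Phi> t) (\<Gamma> (\<Phi> t) (\<Phi>' h) i) j + K (\<Phi> t) i (\<Gamma> (\<Phi> t) (\<Phi>' h) j)) +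
      ((V t \<bullet> i) * (W' h \<bullet> j) + (V' h \<bullet> i) * (W t \<bullet> j)) * K (\<Phi> t) i j)) (at t)"
    by (intro has_derivative_sum has_derivative_mult has_derivative_inner_left V W dK)
  moreover have "(\<Sum>i\<in>Basis. \<Sum>j\<in>Basis.
      (V t \<bullet> i) * (W t \<bullet> j) * (K (\<Phi> t) (\<Gamma> (\<Phi> t) (\<Phi>' h) i) j + K (\<Phi> t) i (\<Gamma> (\<Phi> t) (\<Phi>' h) j)) +
      ((V t \<bullet> i) * (W' h \<bullet> j) + (V' h \<bullet> i) * (W t \<bullet> j)) * K (\<Phi> t) i j) =
     K (\<Phi> t) (V' h + \<Gamma> (\<Phi> t) (\<Phi>' h) (V t)) (W t) + K (\<Phi> t) (V t) (W' h + \<Gamma> (\<Phi> t) (\<Phi>' h) (W t))" for h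
  proof -
    have 1: "bilinear (\<lambda>v w. K (\<Phi> t) (\<Gamma> (\<Phi> t) (\<Phi>' h) v) w)"
      using linear_compose[OF l\<Gamma> lK1] lK2 by (auto simp: bilinear_def o_def)
    have 2: "bilinear (\<lambda>v w. K (\<Phi> t) v (\<Gamma> (\<Phi> t) (\<Phi>' h) w))"
      using linear_compose[OF l\<Gamma> lK2] lK1 by (auto simp: bilinear_def o_def)
    show ?thesis
      unfolding bilinear_ladd[OF b] bilinear_radd[OF b]
        bilinear_expand[OF 1, of "V t" "W t"] bilinear_expand[OF 2, of "V t" "W t"]
        bilinear_expand[OF b, of "V' h" "W t"] bilinear_expand[OF b, of "V t" "W' h"]
        sum.distrib[symmetric]
      by (intro sum.cong refl) (simp add: algebra_simps)
  qed
  ultimately have E: "(?E has_derivative (\<lambda>h. K (\<Phi> t) (V' h + \<Gamma> (\<Phi> t) (\<Phi>' h) (V t)) (W t) + K (\<Phi> t) (V t) (W' h + \<Gamma> (\<Phi> t) (\<Phi>' h) (W t)))) (at t)"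
    by simp
  have "\<forall>\<^sub>F s in at t. \<Phi> s \<in> S"
    using has_derivative_continuous[OF \<Phi>] S t by (simp add: continuous_at topological_tendstoD)
  then have ev: "\<forall>\<^sub>F s in at t. ?E s = K (\<Phi> s) (V s) (W s)"
    by eventually_elim (rule bilinear_expand[OF bil, symmetric])
  show ?thesis
    by (rule has_derivative_transform_eventually[OF E ev])
      (use bilinear_expand[OF b, of "V t" "W t"] in auto)
qed

text \<open>The covariant derivative, along \<open>h\<close>, of the field \<open>\<partial>\<^sub>v \<Phi>\<close> along the map \<open>\<Phi>\<close>. Formulating it for fields
along a map avoids extending them to the ambient manifold.\<close>

definition cov_deriv :: "('c::real_normed_vector \<Rightarrow> 'c \<Rightarrow> 'c \<Rightarrow> 'c) \<Rightarrow> ('e::real_normed_vector \<Rightarrow> 'c) \<Rightarrow> 'e \<Rightarrow> 'e \<Rightarrow> 'e \<Rightarrow> 'c" where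
  "cov_deriv \<Gamma> \<Phi> u h v = frechet_derivative (\<lambda>x. frechet_derivative \<Phi> (at x) v) (at u) h +
     \<Gamma> (\<Phi> u) (frechet_derivative \<Phi> (at u) h) (frechet_derivative \<Phi> (at u) v)"

text \<open>Mixed second derivatives commute, and the connection term is symmetric because there is no torsion.\<close>

lemma cov_deriv_commute:
  fixes \<Phi> :: "'e::real_normed_vector \<Rightarrow> 'c::euclidean_space"
  assumes "christoffel S \<Gamma>" "open U" "Ck_on 2 U \<Phi>" "u \<in> U" "\<Phi> u \<in> S"
  shows "cov_deriv \<Gamma> \<Phi> u v w = cov_deriv \<Gamma> \<Phi> u w v"
  using mixed_derivatives[OF assms(2,4,3)] assms(1,5) by (auto simp: cov_deriv_def christoffel_def)

lemma form_along_has_derivative: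
  fixes \<Phi> :: "'e::real_normed_vector \<Rightarrow> 'c::euclidean_space"
  assumes S: "open S" and \<Gamma>: "christoffel S \<Gamma>" and K: "parallel_form S \<Gamma> K"
    and U: "open U" "Ck_on 2 U \<Phi>" "u \<in> U" "\<Phi> u \<in> S"
  shows "((\<lambda>u. K (\<Phi> u) (frechet_derivative \<Phi> (at u) v) (frechet_derivative \<Phi> (at u) w)) has_derivative
     (\<lambda>h. K (\<Phi> u) (cov_deriv \<Gamma> \<Phi> u h v) (frechet_derivative \<Phi> (at u) w) +
          K (\<Phi> u) (frechet_derivative \<Phi> (at u) v) (cov_deriv \<Gamma> \<Phi> u h w))) (at u)"
  unfolding cov_deriv_def
proof (rule parallel_form_has_derivative[where \<Phi> = \<Phi> and t = u, OF S \<Gamma> K U(4)])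
  have c: "Ck_on (Suc (Suc 0)) U \<Phi>" using U by (simp add: numeral_2_eq_2)
  show "(\<Phi> has_derivative frechet_derivative \<Phi> (at u)) (at u)"
    using Ck_on_has_derivative[OF c] U by blast
  have d: "((\<lambda>x. frechet_derivative \<Phi> (at x) v) has_derivative
      frechet_derivative (\<lambda>x. frechet_derivative \<Phi> (at x) v) (at u)) (at u)" for v
    using c U by (auto simp flip: frechet_derivative_works)
  show "((\<lambda>x. frechet_derivative \<Phi> (at x) v) has_derivative
      frechet_derivative (\<lambda>x. frechet_derivative \<Phi> (at x) v) (at u)) (at u)"
    and "((\<lambda>x. frechet_derivative \<Phi> (at x) w) has_derivative
      frechet_derivative (\<lambda>x. frechet_derivative \<Phi> (at x) w) (at u)) (at u)"
    by (rule d)+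
qed

text \<open>By symmetry \<open>D\<^sub>x \<Phi>\<^sub>z = D\<^sub>z \<Phi>\<^sub>x\<close>, and differentiating \<open>K(\<Phi>\<^sub>x, \<Phi>\<^sub>z) = 0\<close> along \<open>z\<close> moves the
derivative from \<open>\<Phi>\<^sub>x\<close> to \<open>\<Phi>\<^sub>z\<close>. The result depends on \<open>x\<close> only through \<open>\<Phi>\<^sub>x\<close>, and does so linearly.\<close>

lemma orthogonal_form_derivative:
  fixes \<Phi> :: "'e::real_normed_vector \<Rightarrow> 'c::euclidean_space"
  assumes S: "open S" and \<Gamma>: "christoffel S \<Gamma>" and K: "parallel_form S \<Gamma> K"
    and U: "open U" "Ck_on 2 U \<Phi>" "u \<in> U" "\<Phi> u \<in> S"
    and orth: "\<And>u. u \<in> U \<Longrightarrow> K (\<Phi> u) (frechet_derivative \<Phi> (at u) x) (frechet_derivative \<Phi> (at u) z) = 0"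
    and D: "((\<lambda>u. K (\<Phi> u) (frechet_derivative \<Phi> (at u) z) (frechet_derivative \<Phi> (at u) z)) has_derivative D) (at u)"
  shows "D x = - 2 * K (\<Phi> u) (frechet_derivative \<Phi> (at u) x) (cov_deriv \<Gamma> \<Phi> u z z)"
proof -
  let ?d = "\<lambda>v. frechet_derivative \<Phi> (at u) v"
  note fd = form_along_has_derivative[OF S \<Gamma> K U]
  have sym: "K (\<Phi> u) v w = K (\<Phi> u) w v" for v w using K U(4) by (auto simp: parallel_form_def)
  have "D = (\<lambda>h. K (\<Phi> u) (cov_deriv \<Gamma> \<Phi> u h z) (?d z) + K (\<Phi> u) (?d z) (cov_deriv \<Gamma> \<Phi> u h z))"
    by (rule has_derivative_unique[OF D fd])
  then have 1: "D x = 2 * K (\<Phi> u) (cov_deriv \<Gamma> \<Phi> u x z) (?d z)"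
    using sym[of "?d z"] by simp
  \<comment> \<open>Orthogonality on all of \<open>U\<close>, not only at \<open>u\<close>, is what may be differentiated.\<close>
  have "((\<lambda>u. K (\<Phi> u) (frechet_derivative \<Phi> (at u) x) (frechet_derivative \<Phi> (at u) z)) has_derivative (\<lambda>h. 0)) (at u)"
    by (rule has_derivative_transform_within_open[OF has_derivative_const U(1,3)]) (use orth in auto)
  from fun_cong[OF has_derivative_unique[OF this fd], of z]
  have "K (\<Phi> u) (cov_deriv \<Gamma> \<Phi> u z x) (?d z) = - K (\<Phi> u) (?d x) (cov_deriv \<Gamma> \<Phi> u z z)" by simp
  then show ?thesis using 1 cov_deriv_commute[OF \<Gamma> U, of x z] by simp
qed

section \<open>The metric and the metallic structure in coordinates\<close>

definition coord_form :: "('k, 'c::euclidean_space) chart set \<Rightarrow> ('k, 'c) chart \<Rightarrow>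
    ('k \<Rightarrow> ('k, 'c) tvec \<Rightarrow> ('k, 'c) tvec \<Rightarrow> real) \<Rightarrow> 'c \<Rightarrow> 'c \<Rightarrow> 'c \<Rightarrow> real" where
  "coord_form B d K u v w = K (cinv d u) (coord_vec B d (cinv d u) v) (coord_vec B d (cinv d u) w)"

lemma coord_form_bilinear:
  assumes B: "diff_atlas B" "d \<in> B" "u \<in> cmap d ` cdom d"
    and sym: "\<And>p X Y. X \<in> tangent_space B p \<Longrightarrow> Y \<in> tangent_space B p \<Longrightarrow> K p X Y = K p Y X"
    and lin: "\<And>p X Y Z r. X \<in> tangent_space B p \<Longrightarrow> Y \<in> tangent_space B p \<Longrightarrow> Z \<in> tangent_space B p \<Longrightarrow>
        K p (r *\<^sub>R X + Y) Z = r * K p X Z + K p Y Z"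
  shows "bilinear (coord_form B d K u)" "coord_form B d K u v w = coord_form B d K u w v"
proof -
  have p: "cinv d u \<in> cdom d" using chart_inverse(2)[OF diff_atlasD(1)] B by blast
  note T = coord_vec_tangent[OF B(1,2) p]
  show s: "coord_form B d K u v w = coord_form B d K u w v" for v w
    unfolding coord_form_def by (intro sym T)
  have "linear (\<lambda>x. coord_form B d K u x y)" for y
    by (rule linear_scale_addI) (simp add: coord_form_def coord_vec_scale_add[OF B(1,2) p] lin T)
  moreover have "linear (coord_form B d K u x)" if "linear (\<lambda>y. coord_form B d K u y x)" for x
  proof -
    have "coord_form B d K u x = (\<lambda>y. coord_form B d K u y x)" by (intro ext s)
    then show ?thesis using that by simp
  qed
  ultimately show "bilinear (coord_form B d K u)" by (simp add: bilinear_def)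
qed

lemma riemannian_metricD:
  assumes g: "riemannian_metric A g"
  shows "X \<in> tangent_space A p \<Longrightarrow> Y \<in> tangent_space A p \<Longrightarrow> g p X Y = g p Y X"
    and "X \<in> tangent_space A p \<Longrightarrow> Y \<in> tangent_space A p \<Longrightarrow> Z \<in> tangent_space A p \<Longrightarrow>
        g p (r *\<^sub>R X + Y) Z = r * g p X Z + g p Y Z"
    and "X \<in> tangent_space A p \<Longrightarrow> X \<noteq> 0 \<Longrightarrow> g p X X > 0"
    and "open U \<Longrightarrow> smooth_vector_field A U V \<Longrightarrow> smooth_vector_field A U W \<Longrightarrow>
        smooth_fun A U (\<lambda>q. g q (V q) (W q))"
proof -
  note h = g[unfolded riemannian_metric_def]
  show "X \<in> tangent_space A p \<Longrightarrow> Y \<in> tangent_space A p \<Longrightarrow> g p X Y = g p Y X"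
    by (rule h[THEN conjunct1, rule_format])
  show "X \<in> tangent_space A p \<Longrightarrow> Y \<in> tangent_space A p \<Longrightarrow> Z \<in> tangent_space A p \<Longrightarrow>
        g p (r *\<^sub>R X + Y) Z = r * g p X Z + g p Y Z"
    by (rule h[THEN conjunct2, THEN conjunct1, rule_format])
  show "X \<in> tangent_space A p \<Longrightarrow> X \<noteq> 0 \<Longrightarrow> g p X X > 0"
    by (rule h[THEN conjunct2, THEN conjunct2, THEN conjunct1, rule_format])
  show "open U \<Longrightarrow> smooth_vector_field A U V \<Longrightarrow> smooth_vector_field A U W \<Longrightarrow>
        smooth_fun A U (\<lambda>q. g q (V q) (W q))"
    by (rule h[THEN conjunct2, THEN conjunct2, THEN conjunct2, rule_format])
qed

lemma affine_connectionD:
  assumes nab: "affine_connection A nab" and U: "open U"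
    and X: "smooth_vector_field A U X" and Y: "smooth_vector_field A U Y"
  shows "smooth_vector_field A U (nab X Y)"
    and "smooth_vector_field A U Y' \<Longrightarrow> (\<And>p. p \<in> U \<Longrightarrow> Y p = Y' p) \<Longrightarrow> p \<in> U \<Longrightarrow> nab X Y p = nab X Y' p"
    and "smooth_vector_field A U Z \<Longrightarrow> smooth_fun A U h \<Longrightarrow> p \<in> U \<Longrightarrow>
      nab X (\<lambda>q. h q *\<^sub>R Y q + Z q) p = dir_deriv A p (X p) h *\<^sub>R Y p + h p *\<^sub>R nab X Y p + nab X Z p"
proof -
  note c = nab[unfolded affine_connection_def, rule_format, OF U]
  show "smooth_vector_field A U (nab X Y)"
    by (rule c[THEN conjunct1, rule_format, OF X Y])
  show "nab X Y p = nab X Y' p"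
    if "smooth_vector_field A U Y'" "\<And>p. p \<in> U \<Longrightarrow> Y p = Y' p" "p \<in> U"
    by (rule c[THEN conjunct2, THEN conjunct1, rule_format, OF X Y X that(1) _ that(3)])
      (use that(2) in simp)
  show "nab X (\<lambda>q. h q *\<^sub>R Y q + Z q) p = dir_deriv A p (X p) h *\<^sub>R Y p + h p *\<^sub>R nab X Y p + nab X Z p"
    if "smooth_vector_field A U Z" "smooth_fun A U h" "p \<in> U"
    using c[THEN conjunct2, THEN conjunct2, rule_format, OF X Y that] by blast
qed

text \<open>\<open>\<Gamma>\<close> consists of the coordinates of \<open>\<nabla>\<close> applied to coordinate fields. It is symmetric because the
derivatives of the coordinate functions along coordinate fields are constant, so that brackets of
coordinate fields annihilate the coordinate functions.\<close>

lemma levi_civita_christoffel: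
  assumes B: "smooth_manifold B" "d \<in> B" and nab: "affine_connection B nab" "torsion_free B nab"
  obtains \<Gamma> where "christoffel (cmap d ` cdom d) \<Gamma>"
    "\<And>p h v. p \<in> cdom d \<Longrightarrow> nab (\<lambda>q. coord_vec B d q h) (\<lambda>q. coord_vec B d q v) p =
        coord_vec B d p (\<Gamma> (cmap d p) h v)"
proof -
  let ?E = "\<lambda>v q. coord_vec B d q v"
  define \<Gamma> where "\<Gamma> u h v = nab (?E h) (?E v) (cinv d u) d" for u h v
  note dB = smooth_manifold_diff_atlas[OF B(1)]
  have id: "is_chart d" and od: "open (cdom d)" "open (cmap d ` cdom d)"
    using diff_atlasD(1)[OF dB B(2)] by (auto simp: is_chart_def)
  have sm: "smooth_vector_field B (cdom d) (?E v)" for v by (rule coord_vec_smooth[OF B])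
  have nabT: "nab (?E h) (?E v) p \<in> tangent_space B p" if "p \<in> cdom d" for h v p
    using affine_connectionD(1)[OF nab(1) od(1) sm sm] that unfolding smooth_vector_field_def by blast
  have nabE: "nab (?E h) (?E v) p = coord_vec B d p (\<Gamma> (cmap d p) h v)" if "p \<in> cdom d" for h v p
    using tangent_eq_coord_vec[OF B(2) that nabT[OF that]] chart_inverse(1)[OF id that]
    by (simp add: \<Gamma>_def)
  have sc: "smooth_fun B (cdom d) (\<lambda>_. r)" for r
    unfolding smooth_fun_def smooth_on_def
  proof (intro ballI allI)
    fix c k assume "c \<in> B"
    then have "open (cmap c ` (cdom d \<inter> cdom c))"
      using chart_open_image[OF diff_atlasD(1)[OF dB], of c "cdom d"] od by (simp add: Int_commute)
    then show "Ck_on k (cmap c ` (cdom d \<inter> cdom c)) ((\<lambda>_. r) \<circ> cinv c)"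
      by (simp add: o_def Ck_on_const)
  qed
  have lin: "\<Gamma> u h (r *\<^sub>R v + w) = r *\<^sub>R \<Gamma> u h v + \<Gamma> u h w" if u: "u \<in> cmap d ` cdom d" for u h r v w
  proof -
    let ?p = "cinv d u"
    have p: "?p \<in> cdom d" using chart_inverse(2)[OF id] u by blast
    have eq: "r *\<^sub>R ?E v q + ?E w q = ?E (r *\<^sub>R v + w) q" if "q \<in> cdom d" for q
      using coord_vec_scale_add[OF dB B(2) that] by metis
    have s2: "smooth_vector_field B (cdom d) (\<lambda>q. r *\<^sub>R ?E v q + ?E w q)"
    proof -
      have "smooth_on (cmap c ` (cdom d \<inter> cdom c)) (\<lambda>u. (r *\<^sub>R ?E v (cinv c u) + ?E w (cinv c u)) c)"
        if c: "c \<in> B" for c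
      proof -
        have oc: "open (cmap c ` (cdom d \<inter> cdom c))"
          using chart_open_image[OF diff_atlasD(1)[OF dB c], of "cdom d"] od by (simp add: Int_commute)
        have "smooth_on (cmap c ` (cdom d \<inter> cdom c)) (\<lambda>u. ?E (r *\<^sub>R v + w) (cinv c u) c)"
          using sm c unfolding smooth_vector_field_def by blast
        then show ?thesis
          by (rule smooth_on_cong[OF oc, rotated])
            (use chart_inverse(1)[OF diff_atlasD(1)[OF dB c]] in \<open>auto simp: eq[symmetric]\<close>)
      qed
      moreover have "r *\<^sub>R ?E v q + ?E w q \<in> tangent_space B q" if "q \<in> cdom d" for q
        unfolding eq[OF that] by (rule coord_vec_tangent[OF dB B(2) that])
      ultimately show ?thesis unfolding smooth_vector_field_def by blast
    qed
    have "nab (?E h) (\<lambda>q. r *\<^sub>R ?E v q + ?E w q) ?p =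
        dir_deriv B ?p (?E h ?p) (\<lambda>_. r) *\<^sub>R ?E v ?p + r *\<^sub>R nab (?E h) (?E v) ?p + nab (?E h) (?E w) ?p"
      by (rule affine_connectionD(3)[OF nab(1) od(1) sm sm sm sc p])
    moreover have "dir_deriv B ?p (?E h ?p) (\<lambda>_. r) = 0"
      by (simp add: dir_deriv_def o_def)
    moreover have "nab (?E h) (\<lambda>q. r *\<^sub>R ?E v q + ?E w q) ?p = nab (?E h) (?E (r *\<^sub>R v + w)) ?p"
      by (rule affine_connectionD(2)[OF nab(1) od(1) sm s2 sm eq p])
    ultimately have "nab (?E h) (?E (r *\<^sub>R v + w)) ?p = r *\<^sub>R nab (?E h) (?E v) ?p + nab (?E h) (?E w) ?p"
      by simp
    from fun_cong[OF this, of d] show ?thesis by (simp add: \<Gamma>_def scaleR_fun_def)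
  qed
  have sym: "\<Gamma> u h v = \<Gamma> u v h" if u: "u \<in> cmap d ` cdom d" for u h v
  proof (rule euclidean_eqI)
    fix b :: 'b assume "b \<in> Basis"
    let ?p = "cinv d u" and ?h = "\<lambda>q. cmap d q \<bullet> b"
    have p: "?p \<in> cdom d" and up: "cmap d ?p = u" using chart_inverse[OF id] u by auto
    have dh: "(?h \<circ> cinv d has_derivative (\<lambda>v. v \<bullet> b)) (at (cmap d q))" if "q \<in> cdom d" for q
      by (rule has_derivative_transform_within_open[OF _ od(2)])
        (use that chart_inverse(3)[OF id] in \<open>auto intro!: derivative_eq_intros\<close>)
    have const: "dir_deriv B q (?E v q) ?h = v \<bullet> b" if "q \<in> cdom d" for q v
      by (rule dir_deriv_coord_vec[OF dB B(2) that dh[OF that]])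
    have zero: "dir_deriv B ?p (?E v ?p) (\<lambda>q. dir_deriv B q (?E w q) ?h) = 0" for v w
    proof -
      have "((\<lambda>q. dir_deriv B q (?E w q) ?h) \<circ> cinv d has_derivative (\<lambda>v. 0)) (at (cmap d ?p))"
        by (rule has_derivative_transform_within_open[OF has_derivative_const od(2)])
          (use const chart_inverse(2)[OF id] up u in auto)
      from dir_deriv_coord_vec[OF dB B(2) p this] show ?thesis .
    qed
    have "dir_deriv B ?p (nab (?E h) (?E v) ?p - nab (?E v) (?E h) ?p) ?h = 0"
      using nab(2) od(1) sm coordinate_smooth[OF B, of b] p zero unfolding torsion_free_def by simp
    moreover have "nab (?E h) (?E v) ?p - nab (?E v) (?E h) ?p = ?E (\<Gamma> u h v - \<Gamma> u v h) ?p"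
      using coord_vec_scale_add[OF dB B(2) p, of "-1" "\<Gamma> u v h" "\<Gamma> u h v"] nabE[OF p] up
      by simp
    ultimately have "(\<Gamma> u h v - \<Gamma> u v h) \<bullet> b = 0"
      using dir_deriv_coord_vec[OF dB B(2) p dh[OF p]] by simp
    then show "\<Gamma> u h v \<bullet> b = \<Gamma> u v h \<bullet> b" by (simp add: inner_diff_left)
  qed
  have "linear (\<Gamma> u h)" if "u \<in> cmap d ` cdom d" for u h
    by (rule linear_scale_addI) (rule lin[OF that])
  moreover from this have "linear (\<lambda>v. \<Gamma> u v h)" if "u \<in> cmap d ` cdom d" for u h
  proof -
    have "(\<lambda>v. \<Gamma> u v h) = \<Gamma> u h" by (intro ext sym[OF that])
    then show ?thesis using \<open>\<And>u h. u \<in> cmap d ` cdom d \<Longrightarrow> linear (\<Gamma> u h)\<close>[OF that] by simp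
  qed
  ultimately have "christoffel (cmap d ` cdom d) \<Gamma>"
    using sym by (auto simp: christoffel_def bilinear_def)
  then show thesis using nabE that by blast
qed

lemma metric_deriv_coord:
  assumes B: "smooth_manifold B" "d \<in> B" and g: "riemannian_metric B g" "metric_connection B g nab"
    and Y: "smooth_vector_field B (cdom d) Y" and Z: "smooth_vector_field B (cdom d) Z" and p: "p \<in> cdom d"
  shows "((\<lambda>u. g (cinv d u) (Y (cinv d u)) (Z (cinv d u))) has_derivative
    (\<lambda>h. g p (nab (\<lambda>q. coord_vec B d q h) Y p) (Z p) + g p (Y p) (nab (\<lambda>q. coord_vec B d q h) Z p))) (at (cmap d p))"
proof -
  note dB = smooth_manifold_diff_atlas[OF B(1)]
  have id: "is_chart d" and od: "open (cdom d)" "open (cmap d ` cdom d)"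
    using diff_atlasD(1)[OF dB B(2)] by (auto simp: is_chart_def)
  let ?f = "\<lambda>q. g q (Y q) (Z q)"
  have "smooth_fun B (cdom d) ?f" by (rule riemannian_metricD(4)[OF g(1) od(1) Y Z])
  then have "smooth_on (cmap d ` (cdom d \<inter> cdom d)) (?f \<circ> cinv d)"
    using B(2) unfolding smooth_fun_def by blast
  then have df: "(?f \<circ> cinv d has_derivative frechet_derivative (?f \<circ> cinv d) (at (cmap d p))) (at (cmap d p))"
    by (rule smooth_on_has_derivative) (use p in auto)
  have "frechet_derivative (?f \<circ> cinv d) (at (cmap d p)) h =
      g p (nab (\<lambda>q. coord_vec B d q h) Y p) (Z p) + g p (Y p) (nab (\<lambda>q. coord_vec B d q h) Z p)" for h
    using dir_deriv_coord_vec[OF dB B(2) p df, of h]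
      g(2)[unfolded metric_connection_def, rule_format, OF od(1) coord_vec_smooth[OF B, of h] Y Z p]
    by simp
  then have "frechet_derivative (?f \<circ> cinv d) (at (cmap d p)) =
      (\<lambda>h. g p (nab (\<lambda>q. coord_vec B d q h) Y p) (Z p) + g p (Y p) (nab (\<lambda>q. coord_vec B d q h) Z p))" ..
  then show ?thesis using df by (simp add: o_def)
qed

text \<open>The form \<open>g(X, J Y)\<close> is parallel since \<open>g\<close> and \<open>J\<close> are, and symmetric since \<open>J\<close> is self-adjoint.\<close>

lemma locally_metallic_coordinates:
  assumes lm: "locally_metallic B g J" and d: "d \<in> B"
  obtains \<Gamma> where "christoffel (cmap d ` cdom d) \<Gamma>"
    "parallel_form (cmap d ` cdom d) \<Gamma> (coord_form B d g)"
    "parallel_form (cmap d ` cdom d) \<Gamma> (coord_form B d (\<lambda>p X Y. g p X (J p Y)))"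
proof -
  obtain nab where nab: "affine_connection B nab" "torsion_free B nab" "metric_connection B g nab"
    "parallel_1_1 B nab J"
    using lm unfolding locally_metallic_def levi_civita_def by blast
  have B: "smooth_manifold B" and g: "riemannian_metric B g" and J: "tensor_field_1_1 B J"
    and gJ: "\<And>p X Y. X \<in> tangent_space B p \<Longrightarrow> Y \<in> tangent_space B p \<Longrightarrow> g p (J p X) Y = g p X (J p Y)"
    using lm unfolding locally_metallic_def metallic_riemannian_def riemannian_manifold_def by blast+
  note dB = smooth_manifold_diff_atlas[OF B(1)]
  have id: "is_chart d" and od: "open (cdom d)"
    using diff_atlasD(1)[OF dB d] by (auto simp: is_chart_def)
  note gs = riemannian_metricD(1)[OF g] and gl = riemannian_metricD(2)[OF g]
  have JT: "\<And>p X. X \<in> tangent_space B p \<Longrightarrow> J p X \<in> tangent_space B p"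
    using J[unfolded tensor_field_1_1_def, THEN conjunct1, rule_format] .
  obtain \<Gamma> where \<Gamma>: "christoffel (cmap d ` cdom d) \<Gamma>"
    "\<And>p h v. p \<in> cdom d \<Longrightarrow> nab (\<lambda>q. coord_vec B d q h) (\<lambda>q. coord_vec B d q v) p =
        coord_vec B d p (\<Gamma> (cmap d p) h v)"
    using levi_civita_christoffel[OF B d nab(1,2)] by blast
  let ?E = "\<lambda>v q. coord_vec B d q v"
  have sm: "smooth_vector_field B (cdom d) (?E v)" for v by (rule coord_vec_smooth[OF B d])
  then have smJ: "smooth_vector_field B (cdom d) (\<lambda>q. J q (?E v q))" for v
    using J[unfolded tensor_field_1_1_def, THEN conjunct2, THEN conjunct2, rule_format, OF od] by blast
  have nabJ: "nab (?E h) (\<lambda>q. J q (?E v q)) p = J p (?E (\<Gamma> (cmap d p) h v) p)" if "p \<in> cdom d" for h v p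
    using nab(4)[unfolded parallel_1_1_def, rule_format, OF od sm sm that] \<Gamma>(2)[OF that] by simp
  show thesis
  proof (rule that[OF \<Gamma>(1)])
    show "parallel_form (cmap d ` cdom d) \<Gamma> (coord_form B d g)"
      unfolding parallel_form_def
    proof (intro ballI conjI allI)
      fix u v w assume u: "u \<in> cmap d ` cdom d"
      show "bilinear (coord_form B d g u)" "coord_form B d g u v w = coord_form B d g u w v"
        using coord_form_bilinear[OF dB d u, of g] gs gl by blast+
      have p: "cinv d u \<in> cdom d" "cmap d (cinv d u) = u" using chart_inverse[OF id] u by auto
      show "((\<lambda>u. coord_form B d g u v w) has_derivative
          (\<lambda>h. coord_form B d g u (\<Gamma> u h v) w + coord_form B d g u v (\<Gamma> u h w))) (at u)"
        using metric_deriv_coord[OF B d g nab(3) sm sm p(1), of v w] \<Gamma>(2)[OF p(1)] p(2)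
        by (simp add: coord_form_def)
    qed
    show "parallel_form (cmap d ` cdom d) \<Gamma> (coord_form B d (\<lambda>p X Y. g p X (J p Y)))"
      unfolding parallel_form_def
    proof (intro ballI conjI allI)
      let ?H = "\<lambda>p X Y. g p X (J p Y)"
      fix u v w assume u: "u \<in> cmap d ` cdom d"
      have 1: "?H p X Y = ?H p Y X" if "X \<in> tangent_space B p" "Y \<in> tangent_space B p" for p X Y
        using gJ[OF that] gs[OF JT[OF that(1)] that(2)] by simp
      show "bilinear (coord_form B d ?H u)" "coord_form B d ?H u v w = coord_form B d ?H u w v"
        using coord_form_bilinear[OF dB d u, of ?H] 1 gl JT by blast+
      have p: "cinv d u \<in> cdom d" "cmap d (cinv d u) = u" using chart_inverse[OF id] u by auto
      show "((\<lambda>u. coord_form B d ?H u v w) has_derivative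
          (\<lambda>h. coord_form B d ?H u (\<Gamma> u h v) w + coord_form B d ?H u v (\<Gamma> u h w))) (at u)"
        using metric_deriv_coord[OF B d g nab(3) sm smJ p(1), of v w] \<Gamma>(2)[OF p(1)] nabJ[OF p(1)] p(2)
        by (simp add: coord_form_def)
    qed
  qed
qed

text \<open>\<open>j q\<close> is the matrix of \<open>J\<close> at \<open>q\<close>, read in the chart \<open>d\<close>.\<close>

lemma metallic_operator_coordinates:
  assumes lm: "locally_metallic B g J" and d: "d \<in> B"
  obtains a b j where "a > 0" "b > 0"
    "\<And>q v. q \<in> cdom d \<Longrightarrow> J q (coord_vec B d q v) = coord_vec B d q (j q v)"
    "\<And>q. q \<in> cdom d \<Longrightarrow> linear (j q)"
    "\<And>q v. q \<in> cdom d \<Longrightarrow> j q (j q v) = a *\<^sub>R j q v + b *\<^sub>R v"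
proof -
  have m: "metallic_riemannian B g J" using lm by (simp add: locally_metallic_def)
  note m1 = m[unfolded metallic_riemannian_def]
  have B: "smooth_manifold B" using m1[THEN conjunct1] by (simp add: riemannian_manifold_def)
  note dB = smooth_manifold_diff_atlas[OF B]
  note J = m1[THEN conjunct2, THEN conjunct1, unfolded tensor_field_1_1_def]
  obtain a b :: nat where ab: "a > 0" "b > 0"
    "\<And>p X. X \<in> tangent_space B p \<Longrightarrow> J p (J p X) = real a *\<^sub>R J p X + real b *\<^sub>R X"
    using m1[THEN conjunct2, THEN conjunct2, THEN conjunct1] by blast
  let ?j = "\<lambda>q v. J q (coord_vec B d q v) d"
  have T: "coord_vec B d q v \<in> tangent_space B q" if "q \<in> cdom d" for q v
    using coord_vec_tangent[OF dB d that] .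
  have 1: "J q (coord_vec B d q v) = coord_vec B d q (?j q v)" if "q \<in> cdom d" for q v
    by (rule tangent_eq_coord_vec[OF d that J[THEN conjunct1, rule_format, OF T[OF that]]])
  have 2: "linear (?j q)" if "q \<in> cdom d" for q
  proof (rule linear_scale_addI)
    fix r v w
    have "J q (coord_vec B d q (r *\<^sub>R v + w)) = r *\<^sub>R J q (coord_vec B d q v) + J q (coord_vec B d q w)"
      unfolding coord_vec_scale_add[OF dB d that]
      by (rule J[THEN conjunct2, THEN conjunct1, rule_format, OF T[OF that] T[OF that]])
    from fun_cong[OF this, of d] show "?j q (r *\<^sub>R v + w) = r *\<^sub>R ?j q v + ?j q w"
      by (simp add: scaleR_fun_def)
  qed
  have 3: "?j q (?j q v) = real a *\<^sub>R ?j q v + real b *\<^sub>R v" if "q \<in> cdom d" for q v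
  proof -
    have "J q (coord_vec B d q (?j q v)) = real a *\<^sub>R J q (coord_vec B d q v) + real b *\<^sub>R coord_vec B d q v"
      unfolding 1[OF that, symmetric] by (rule ab(3)[OF T[OF that]])
    from fun_cong[OF this, of d] show ?thesis
      by (simp add: scaleR_fun_def coord_vec_same[OF dB d that])
  qed
  show thesis
    by (rule that[of "real a" "real b" ?j]) (use ab 1 2 3 in simp_all)
qed

section \<open>Slant angles and eigenvectors\<close>

lemma bilinear_form_cauchy_schwarz:
  fixes m :: "'b::real_vector \<Rightarrow> 'b \<Rightarrow> real"
  assumes m: "bilinear m" and sym: "\<And>x y. m x y = m y x" and pos: "\<And>x. x \<noteq> 0 \<Longrightarrow> m x x > 0"
  shows "(m x y)\<^sup>2 \<le> m x x * m y y"
proof (cases "y = 0")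
  case True
  then show ?thesis by (simp add: bilinear_rzero[OF m])
next
  case False
  let ?a = "m y y" and ?b = "m x y"
  have nn: "m z z \<ge> 0" for z using pos[of z] bilinear_rzero[OF m] by (cases "z = 0") (auto simp: less_imp_le)
  have "m (?a *\<^sub>R x - ?b *\<^sub>R y) (?a *\<^sub>R x - ?b *\<^sub>R y) = ?a * (?a * m x x - ?b\<^sup>2)"
    by (simp add: bilinear_lsub[OF m] bilinear_rsub[OF m] bilinear_lmul[OF m] bilinear_rmul[OF m]
        sym[of y x] power2_eq_square algebra_simps)
  then have "?a * (?a * m x x - ?b\<^sup>2) \<ge> 0" using nn by metis
  then show ?thesis using pos[OF False] by (simp add: zero_le_mult_iff mult.commute)
qed

text \<open>The map that sends \<open>z\<close> to the values of \<open>m z\<close> on the standard basis is injective by definiteness,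
hence surjective in finite dimension.\<close>

lemma bilinear_form_riesz:
  fixes m :: "'b::euclidean_space \<Rightarrow> 'b \<Rightarrow> real"
  assumes m: "bilinear m" and pos: "\<And>x. x \<noteq> 0 \<Longrightarrow> m x x > 0" and l: "linear l"
  shows "\<exists>z. \<forall>w. m z w = l w"
proof -
  have m1: "linear (\<lambda>z. m z w)" and m2: "linear (m z)" for z w using m by (auto simp: bilinear_def)
  have ext: "g = h" if "linear g" "linear h" "\<And>i. i \<in> Basis \<Longrightarrow> g i = h i" for g h :: "'b \<Rightarrow> real"
    using linear_eq_stdbasis[OF that] .
  define L where "L z = (\<Sum>i\<in>Basis. m z i *\<^sub>R i)" for z
  have Li: "L z \<bullet> i = m z i" if "i \<in> Basis" for z i
    using that by (simp add: L_def inner_sum_left inner_Basis if_distrib cong: if_cong)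
  have linL: "linear L"
    unfolding L_def using m1
    by (intro linear_compose_sum ballI) (simp add: linear_iff scaleR_add_left)
  have "inj L"
  proof (rule linear_injective_0[OF linL, THEN iffD2], intro allI impI)
    fix z assume "L z = 0"
    then have "m z = (\<lambda>_. 0)" using Li by (intro ext m2 linear_zero) (metis inner_zero_left)
    then show "z = 0" using pos[of z] by (metis less_irrefl)
  qed
  then have "surj L" using linear_injective_imp_surjective[OF linL] by blast
  then obtain z where z: "L z = (\<Sum>i\<in>Basis. l i *\<^sub>R i)" by (metis surjD)
  have "m z i = l i" if "i \<in> Basis" for i
  proof -
    have "m z i = (\<Sum>i\<in>Basis. l i *\<^sub>R i) \<bullet> i" using Li[OF that, of z] z by simp
    then show ?thesis using that by (simp add: inner_sum_left inner_Basis if_distrib cong: if_cong)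
  qed
  then have "m z = l" by (intro ext m2 l)
  then show ?thesis by auto
qed

text \<open>\<open>E\<close> stands for the passage from coordinates to tangent vectors and \<open>A\<close> for a parametrisation of the
subspace; \<open>A z0\<close> is then the orthogonal projection of \<open>j\<close>. By Pythagoras the quotient in the definition
of the angle lies between 0 and 1, so that \<open>cos\<close> inverts \<open>arccos\<close>.\<close>

lemma subspace_angle_projection:
  fixes E :: "'c::real_vector \<Rightarrow> 'v::real_vector" and A :: "'b::real_vector \<Rightarrow> 'c"
  assumes E: "linear E" and A: "linear A" and G: "bilinear G" and sym: "\<And>x y. G x y = G y x"
    and pos: "\<And>x. x \<noteq> 0 \<Longrightarrow> G x x > 0" and s: "\<And>x y. s (E x) (E y) = G x y"
    and z0: "\<And>w. G (A z0) (A w) = G j (A w)" and j: "j \<noteq> 0"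
    and \<theta>: "subspace_angle s (range (\<lambda>z. E (A z))) (E j) = \<theta>"
  shows "G (A z0) (A z0) = (cos \<theta>)\<^sup>2 * G j j"
proof -
  have E': "E j - E x = E (j - x)" for x by (simp add: linear_diff[OF E])
  have "orth_proj s (range (\<lambda>z. E (A z))) (E j) = E (A z0)"
    unfolding orth_proj_def
  proof (rule the_equality)
    show "E (A z0) \<in> range (\<lambda>z. E (A z)) \<and> (\<forall>u\<in>range (\<lambda>z. E (A z)). s (E j - E (A z0)) u = 0)"
      using z0 by (auto simp: E' s bilinear_lsub[OF G])
  next
    fix w assume w: "w \<in> range (\<lambda>z. E (A z)) \<and> (\<forall>u\<in>range (\<lambda>z. E (A z)). s (E j - w) u = 0)"
    then obtain z where z: "w = E (A z)" by auto
    have "G (j - A z) (A x) = 0" for x using w by (auto simp: z E' s)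
    then have "G (A z - A z0) (A x) = 0" for x using z0[of x] by (simp add: bilinear_lsub[OF G])
    from this[of "z - z0"] have "A z - A z0 = 0"
      using pos[of "A z - A z0"] by (metis less_irrefl linear_diff[OF A])
    then show "w = E (A z0)" by (simp add: z)
  qed
  then have ang: "arccos (sqrt (G (A z0) (A z0)) / sqrt (G j j)) = \<theta>"
    using \<theta> by (simp add: subspace_angle_def s)
  have nn: "G x x \<ge> 0" for x using pos[of x] bilinear_rzero[OF G] by (cases "x = 0") (auto simp: less_imp_le)
  have "G (j - A z0) (j - A z0) = G j j - G (A z0) (A z0)"
    using z0[of z0] by (simp add: bilinear_lsub[OF G] bilinear_rsub[OF G] sym[of "A z0" j])
  then have "G (A z0) (A z0) \<le> G j j" using nn[of "j - A z0"] by simp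
  then have "sqrt (G (A z0) (A z0)) / sqrt (G j j) \<le> 1" using pos[OF j] by simp
  moreover have "0 \<le> sqrt (G (A z0) (A z0)) / sqrt (G j j)" using nn by simp
  ultimately have "cos \<theta> = sqrt (G (A z0) (A z0)) / sqrt (G j j)"
    unfolding ang[symmetric] by (intro cos_arccos) linarith+
  then show ?thesis using pos[OF j] nn[of "A z0"] by (simp add: power_divide)
qed

text \<open>The tangential part \<open>T\<close> of \<open>j\<close> exists by Riesz representation. The squared length of \<open>j (A z)\<close> is
\<open>G(j\<^sup>2 (A z), A z)\<close>, which the quadratic equation for \<open>j\<close> turns into the expression on the right.\<close>

lemma slant_projection:
  fixes E :: "'c::real_vector \<Rightarrow> 'v::real_vector" and A :: "'b::euclidean_space \<Rightarrow> 'c"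
  assumes E: "linear E" and A: "linear A" "\<And>z. A z = 0 \<Longrightarrow> z = 0"
    and G: "bilinear G" and sym: "\<And>x y. G x y = G y x"
    and pos: "\<And>x. x \<noteq> 0 \<Longrightarrow> G x x > 0" and s: "\<And>x y. s (E x) (E y) = G x y"
    and j: "linear j" "\<And>v w. G (j v) w = G v (j w)" "\<And>v. j (j v) = a *\<^sub>R j v + b *\<^sub>R v" and b: "b > 0"
    and \<theta>: "\<And>z. z \<noteq> 0 \<Longrightarrow> subspace_angle s (range (\<lambda>z. E (A z))) (E (j (A z))) = \<theta>"
  shows "\<exists>T. \<forall>z w. G (A (T z)) (A w) = G (j (A z)) (A w) \<and>
    G (A (T z)) (A (T z)) = (cos \<theta>)\<^sup>2 * (a * G (j (A z)) (A z) + b * G (A z) (A z))"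
proof -
  have G1: "linear (\<lambda>x. G x y)" and G2: "linear (G x)" for x y using G by (auto simp: bilinear_def)
  have m: "bilinear (\<lambda>z w. G (A z) (A w))"
    using linear_compose[OF A(1) G1] linear_compose[OF A(1) G2] by (auto simp: bilinear_def o_def)
  have mpos: "G (A z) (A z) > 0" if "z \<noteq> 0" for z using pos A(2) that by blast
  have "\<exists>x. \<forall>w. G (A x) (A w) = G (j (A z)) (A w)" for z
    using bilinear_form_riesz[OF m mpos linear_compose[OF A(1) G2]] by (simp add: o_def)
  then obtain T where T: "\<And>z w. G (A (T z)) (A w) = G (j (A z)) (A w)" by metis
  have "G (A (T z)) (A (T z)) = (cos \<theta>)\<^sup>2 * (a * G (j (A z)) (A z) + b * G (A z) (A z))" for z
  proof (cases "z = 0")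
    case True
    then show ?thesis
      using T[of z "T z"] by (simp add: linear_0[OF A(1)] linear_0[OF j(1)] bilinear_lzero[OF G])
  next
    case False
    then have "A z \<noteq> 0" using A(2) by blast
    then have ne: "j (A z) \<noteq> 0" using j(3)[of "A z"] linear_0[OF j(1)] b by auto
    have "G (j (A z)) (j (A z)) = G (j (j (A z))) (A z)" using j(2) by simp
    also have "\<dots> = a * G (j (A z)) (A z) + b * G (A z) (A z)"
      by (simp add: j(3) bilinear_ladd[OF G] bilinear_lmul[OF G])
    finally show ?thesis
      using subspace_angle_projection[OF E A(1) G sym pos s T ne \<theta>[OF False]] by simp
  qed
  with T show ?thesis by blast
qed

text \<open>Polarising the slant condition gives \<open>T\<^sup>2 = c a T + c b\<close> for the self-adjoint \<open>T\<close>. The polynomial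
\<open>t\<^sup>2 - c a t - c b\<close> has two real roots \<open>l1\<close> and \<open>l2\<close>, since \<open>c b > 0\<close>. For any \<open>z\<^sub>0 \<noteq> 0\<close>, either
\<open>z\<^sub>0\<close> is an eigenvector for \<open>l1\<close>, or \<open>T z\<^sub>0 - l1 z\<^sub>0\<close> is one for \<open>l2\<close>.\<close>

lemma slant_eigenvector:
  fixes m k :: "'b::euclidean_space \<Rightarrow> 'b \<Rightarrow> real" and c a b :: real
  assumes m: "bilinear m" and msym: "\<And>x y. m x y = m y x" and pos: "\<And>x. x \<noteq> 0 \<Longrightarrow> m x x > 0"
    and k: "bilinear k" and ksym: "\<And>x y. k x y = k y x"
    and T: "\<And>x y. m (T x) y = k x y"
    and slant: "\<And>x. m (T x) (T x) = c * (a * k x x + b * m x x)"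
    and cb: "c * b > 0"
  obtains z l where "z \<noteq> 0" "T z = l *\<^sub>R z" "l\<^sup>2 = c * (a * l + b)"
proof -
  have m0: "x = y" if "\<And>w. m x w = m y w" for x y
  proof -
    have "m (x - y) (x - y) = 0" using that[of "x - y"] by (simp add: bilinear_lsub[OF m])
    then show ?thesis using pos[of "x - y"] by fastforce
  qed
  have lin: "T (r *\<^sub>R x + y) = r *\<^sub>R T x + T y" for r x y
    by (rule m0) (simp add: T bilinear_ladd[OF m] bilinear_lmul[OF m] bilinear_ladd[OF k] bilinear_lmul[OF k])
  have linT: "linear T" by (rule linear_scale_addI) (rule lin)
  have pol: "m (T x) (T y) = c * (a * k x y + b * m x y)" for x y
  proof -
    have "m (T (x + y)) (T (x + y)) = m (T x) (T x) + 2 * m (T x) (T y) + m (T y) (T y)"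
      by (simp add: linear_add[OF linT] bilinear_ladd[OF m] bilinear_radd[OF m] msym[of "T y" "T x"])
    moreover have "c * (a * k (x + y) (x + y) + b * m (x + y) (x + y)) =
      c * (a * k x x + b * m x x) + 2 * (c * (a * k x y + b * m x y)) + c * (a * k y y + b * m y y)"
      by (simp add: bilinear_ladd[OF m] bilinear_radd[OF m] bilinear_ladd[OF k] bilinear_radd[OF k]
          msym[of y x] ksym[of y x] algebra_simps)
    ultimately show ?thesis using slant[of "x + y"] slant[of x] slant[of y] by linarith
  qed
  have T2: "T (T x) = (c * a) *\<^sub>R T x + (c * b) *\<^sub>R x" for x
  proof (rule m0)
    fix w
    have "m (T (T x)) w = m (T x) (T w)" using T[of "T x" w] T[of w "T x"] ksym msym by metis
    then show "m (T (T x)) w = m ((c * a) *\<^sub>R T x + (c * b) *\<^sub>R x) w"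
      using pol[of x w] by (simp add: bilinear_ladd[OF m] bilinear_lmul[OF m] T algebra_simps)
  qed
  define D where "D = sqrt ((c * a)\<^sup>2 + 4 * (c * b))"
  have D2: "D\<^sup>2 = (c * a)\<^sup>2 + 4 * (c * b)" using cb by (simp add: D_def)
  define l1 where "l1 = (c * a - D) / 2"
  define l2 where "l2 = (c * a + D) / 2"
  have s: "c * a = l1 + l2" by (simp add: l1_def l2_def field_simps)
  have "l1 * l2 = ((c * a)\<^sup>2 - D\<^sup>2) / 4" by (simp add: l1_def l2_def power2_eq_square algebra_simps)
  then have pr: "c * b = - (l1 * l2)" using D2 by simp
  have r1: "l1\<^sup>2 = c * (a * l1 + b)" and r2: "l2\<^sup>2 = c * (a * l2 + b)"
  proof -
    have h: "c * (a * l + b) = (l1 + l2) * l - l1 * l2" for l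
      using s pr by (simp add: distrib_left mult.assoc[symmetric])
    show "l1\<^sup>2 = c * (a * l1 + b)" "l2\<^sup>2 = c * (a * l2 + b)"
      unfolding h by (simp_all add: power2_eq_square algebra_simps)
  qed
  obtain z0 :: 'b where z0: "z0 \<noteq> 0" using nonzero_Basis nonempty_Basis by blast
  show thesis
  proof (cases "T z0 = l1 *\<^sub>R z0")
    case True
    then show ?thesis using that z0 r1 by blast
  next
    case False
    have "T (T z0 - l1 *\<^sub>R z0) = l2 *\<^sub>R (T z0 - l1 *\<^sub>R z0)"
      unfolding linear_diff[OF linT] linear_scale[OF linT] T2 s pr by (simp add: algebra_simps)
    then show ?thesis using that[of "T z0 - l1 *\<^sub>R z0" l2] False r2 by simp
  qed
qed

text \<open>At \<open>u\<close> the difference of the two sides attains its maximum 0, so its derivative vanishes. This derivative is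
\<open>(2 l - c a) \<alpha> (\<beta>' - l \<alpha>')\<close>, and \<open>2 l - c a\<close> is not zero because its square is the discriminant
\<open>(c a)\<^sup>2 + 4 c b > 0\<close> of the quadratic equation for \<open>l\<close>.\<close>

lemma tight_quadratic_derivative:
  fixes \<alpha> \<beta> :: "'a::euclidean_space \<Rightarrow> real" and a b c l :: real
  assumes U: "open U" "u \<in> U"
    and le: "\<And>x. x \<in> U \<Longrightarrow> (\<beta> x)\<^sup>2 \<le> c * (a * \<beta> x + b * \<alpha> x) * \<alpha> x"
    and d\<alpha>: "(\<alpha> has_derivative \<alpha>') (at u)" and d\<beta>: "(\<beta> has_derivative \<beta>') (at u)"
    and eq: "\<beta> u = l * \<alpha> u" and l: "l\<^sup>2 = c * (a * l + b)" and cb: "c * b > 0" and pos: "\<alpha> u > 0"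
  shows "\<beta>' x = l * \<alpha>' x"
proof -
  let ?F = "\<lambda>x. (\<beta> x)\<^sup>2 - c * (a * \<beta> x + b * \<alpha> x) * \<alpha> x"
  let ?D = "\<lambda>x. 2 * \<beta> u * \<beta>' x - (c * (a * \<beta> u + b * \<alpha> u) * \<alpha>' x + c * (a * \<beta>' x + b * \<alpha>' x) * \<alpha> u)"
  have "(?F has_derivative ?D) (at u)"
    by (auto intro!: derivative_eq_intros d\<alpha> d\<beta> simp: fun_eq_iff)
  moreover have "?F u = 0"
  proof -
    have "?F u = (\<alpha> u)\<^sup>2 * (l\<^sup>2 - c * (a * l + b))"
      unfolding eq by (simp add: power2_eq_square algebra_simps)
    then show ?thesis using l by simp
  qed
  then have "\<forall>y\<in>U. ?F y \<le> ?F u" using le by force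
  ultimately have "?D = (\<lambda>v. 0)"
    using differential_zero_maxmin[OF U(2,1), of ?F ?D] by blast
  then have "?D x = 0" by metis
  then have "\<alpha> u * ((2 * l - c * a) * \<beta>' x - (c * a * l + 2 * (c * b)) * \<alpha>' x) = 0"
    unfolding eq by (simp add: algebra_simps)
  moreover have "c * a * l + 2 * (c * b) = (2 * l - c * a) * l"
    using l by (simp add: power2_eq_square algebra_simps)
  ultimately have "\<alpha> u * ((2 * l - c * a) * \<beta>' x - ((2 * l - c * a) * l) * \<alpha>' x) = 0"
    by (simp only:)
  then have "(2 * l - c * a) * \<beta>' x - ((2 * l - c * a) * l) * \<alpha>' x = 0"
    using pos by (simp only: mult_eq_0_iff) simp
  then have "(2 * l - c * a) * (\<beta>' x - l * \<alpha>' x) = 0"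
    by (simp add: right_diff_distrib mult.assoc)
  moreover have "(2 * l - c * a)\<^sup>2 = (c * a)\<^sup>2 + 4 * (c * b)"
    using l by (simp add: power2_eq_square algebra_simps)
  then have "2 * l - c * a \<noteq> 0" using cb by (metis add_nonneg_pos less_irrefl mult_pos_pos power_zero_numeral
        zero_le_power2 zero_less_numeral)
  ultimately show ?thesis by simp
qed

section \<open>The warping function in coordinates\<close>

text \<open>The parameter space is the product of a chart of the base and a chart of the fiber, \<open>r\<close> is the
warping function, \<open>\<mu>\<close> the fiber metric at the chosen point of the fiber, \<open>c\<close> the squared cosine of the
slant angle there, \<open>j\<close> the metallic operator at the point \<open>\<Phi> (x0, y0)\<close> and \<open>a\<close>, \<open>b\<close> the coefficients of
its quadratic equation. The hypothesis \<open>slant\<close> holds with the same \<open>c\<close> for all \<open>x\<close>, so that the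
Cauchy-Schwarz inequality is one between functions of \<open>x\<close>, for which equality at \<open>x0\<close> is a maximum condition.\<close>

lemma warping_derivative_zero:
  fixes \<Phi> :: "'a::euclidean_space \<times> 'b::euclidean_space \<Rightarrow> 'c::euclidean_space" and c a b :: real
  assumes S: "open S" and \<Gamma>: "christoffel S \<Gamma>" and G: "parallel_form S \<Gamma> G" and H: "parallel_form S \<Gamma> H"
    and U: "open U" "Ck_on 2 U \<Phi>" "(x0, y0) \<in> U" "\<Phi> ` U \<subseteq> S"
    and orthG: "\<And>u x z. u \<in> U \<Longrightarrow> G (\<Phi> u) (frechet_derivative \<Phi> (at u) (x, 0)) (frechet_derivative \<Phi> (at u) (0, z)) = 0"
    and orthH: "\<And>u x z. u \<in> U \<Longrightarrow> H (\<Phi> u) (frechet_derivative \<Phi> (at u) (x, 0)) (frechet_derivative \<Phi> (at u) (0, z)) = 0"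
    and r: "\<And>x z w. (x, y0) \<in> U \<Longrightarrow> G (\<Phi> (x, y0)) (frechet_derivative \<Phi> (at (x, y0)) (0, z)) (frechet_derivative \<Phi> (at (x, y0)) (0, w)) = (r x)\<^sup>2 * \<mu> z w"
    and rpos: "\<And>x. r x > 0" and \<mu>: "\<And>z. z \<noteq> 0 \<Longrightarrow> \<mu> z z > 0"
    and slant: "\<And>x. (x, y0) \<in> U \<Longrightarrow> \<exists>T. \<forall>z w.
        G (\<Phi> (x, y0)) (frechet_derivative \<Phi> (at (x, y0)) (0, T z)) (frechet_derivative \<Phi> (at (x, y0)) (0, w)) =
        H (\<Phi> (x, y0)) (frechet_derivative \<Phi> (at (x, y0)) (0, z)) (frechet_derivative \<Phi> (at (x, y0)) (0, w)) \<and>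
        G (\<Phi> (x, y0)) (frechet_derivative \<Phi> (at (x, y0)) (0, T z)) (frechet_derivative \<Phi> (at (x, y0)) (0, T z)) =
        c * (a * H (\<Phi> (x, y0)) (frechet_derivative \<Phi> (at (x, y0)) (0, z)) (frechet_derivative \<Phi> (at (x, y0)) (0, z))
           + b * G (\<Phi> (x, y0)) (frechet_derivative \<Phi> (at (x, y0)) (0, z)) (frechet_derivative \<Phi> (at (x, y0)) (0, z)))"
    and c: "0 < c" "c < 1" and b: "b > 0"
    and J: "\<And>v w. H (\<Phi> (x0, y0)) v w = G (\<Phi> (x0, y0)) (j v) w" "\<And>v. j (j v) = a *\<^sub>R j v + b *\<^sub>R v"
    and inv: "\<And>x. \<exists>x'. j (frechet_derivative \<Phi> (at (x0, y0)) (x, 0)) = frechet_derivative \<Phi> (at (x0, y0)) (x', 0)"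
  shows "((\<lambda>x. (r x)\<^sup>2) has_derivative (\<lambda>_. 0)) (at x0)"
proof -
  let ?d = "\<lambda>x z. frechet_derivative \<Phi> (at (x, y0)) (0, z)"
  let ?e = "\<lambda>x. frechet_derivative \<Phi> (at (x0, y0)) (x, 0)"
  define m where "m x z w = G (\<Phi> (x, y0)) (?d x z) (?d x w)" for x z w
  define k where "k x z w = H (\<Phi> (x, y0)) (?d x z) (?d x w)" for x z w
  have U2: "Ck_on (Suc (Suc 0)) U \<Phi>" using U(2) by (simp add: numeral_2_eq_2)
  have bilS: "bilinear (K (\<Phi> u))" "K (\<Phi> u) v w = K (\<Phi> u) w v" if "parallel_form S \<Gamma> K" "u \<in> U" for K u v w
    using that U(4) unfolding parallel_form_def by blast+
  have lind: "linear (?d x)" if "(x, y0) \<in> U" for x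
  proof -
    interpret linear "frechet_derivative \<Phi> (at (x, y0))"
      using has_derivative_linear[OF Ck_on_has_derivative[OF U2 that]] .
    show ?thesis by (rule linear_scale_addI) (simp flip: add scale)
  qed
  have bd: "bilinear (\<lambda>z w. K (?d x z) (?d x w))" if "bilinear K" "(x, y0) \<in> U" for K :: "'c \<Rightarrow> 'c \<Rightarrow> real" and x
    using lind[OF that(2)] that(1) unfolding bilinear_def
    by (auto intro: linear_compose[unfolded o_def])
  have bil: "bilinear (m x)" "bilinear (k x)" if "(x, y0) \<in> U" for x
    using bd[OF bilS(1)[OF G that] that] bd[OF bilS(1)[OF H that] that]
    by (simp_all add: m_def[abs_def] k_def[abs_def])
  have sym: "m x z w = m x w z" "k x z w = k x w z" if "(x, y0) \<in> U" for x z w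
    using bilS(2)[OF G that] bilS(2)[OF H that] by (simp_all add: m_def k_def)
  have pos: "m x z z > 0" if "(x, y0) \<in> U" "z \<noteq> 0" for x z
    using r[OF that(1)] rpos[of x] \<mu>[OF that(2)] by (simp add: m_def)
  have slantT: "\<exists>T. (\<forall>z w. m x (T z) w = k x z w) \<and> (\<forall>z. m x (T z) (T z) = c * (a * k x z z + b * m x z z))"
    if "(x, y0) \<in> U" for x
    using slant[OF that] unfolding m_def k_def by blast
  have ineq: "(k x z z)\<^sup>2 \<le> c * (a * k x z z + b * m x z z) * m x z z" if "(x, y0) \<in> U" for x z
  proof -
    obtain T where T: "\<And>z w. m x (T z) w = k x z w" "\<And>z. m x (T z) (T z) = c * (a * k x z z + b * m x z z)"
      using slantT[OF \<open>(x, y0) \<in> U\<close>] by blast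
    show ?thesis
      using bilinear_form_cauchy_schwarz[OF bil(1)[OF that] sym(1)[OF that] pos[OF that], of "T z" z]
      unfolding T(2) unfolding T(1) .
  qed
  obtain T where T: "\<And>z w. m x0 (T z) w = k x0 z w" "\<And>z. m x0 (T z) (T z) = c * (a * k x0 z z + b * m x0 z z)"
    using slantT[OF U(3)] by blast
  have cb: "c * b > 0" using c b by simp
  obtain z l where z: "z \<noteq> 0" "T z = l *\<^sub>R z" and l: "l\<^sup>2 = c * (a * l + b)"
    using slant_eigenvector[OF bil(1)[OF U(3)] sym(1)[OF U(3)] pos[OF U(3)] bil(2)[OF U(3)] sym(2)[OF U(3)] T cb] by blast
  have eig: "k x0 z z = l * m x0 z z"
    using T(1)[of z z] by (simp add: z bilinear_lmul[OF bil(1)[OF U(3)]])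
  \<comment> \<open>The eigenvector \<open>z\<close> stays fixed while \<open>x\<close> varies over the slice \<open>V\<close>; it need not be an eigenvector away from \<open>x0\<close>.\<close>
  define V where "V = {x. (x, y0) \<in> U}"
  have V: "open V" "x0 \<in> V"
    using open_vimage[OF U(1), of "\<lambda>x. (x, y0)"] U(3) by (auto simp: V_def vimage_def continuous_on_Pair)
  let ?n = "cov_deriv \<Gamma> \<Phi> (x0, y0) (0, z) (0, z)"
  have S0: "\<Phi> (x0, y0) \<in> S" using U by auto
  have der: "((\<lambda>x. K (\<Phi> (x, y0)) (?d x z) (?d x z)) has_derivative
      (\<lambda>x. - 2 * K (\<Phi> (x0, y0)) (?e x) ?n)) (at x0)"
    if K: "parallel_form S \<Gamma> K"
     and orth: "\<And>u x z. u \<in> U \<Longrightarrow> K (\<Phi> u) (frechet_derivative \<Phi> (at u) (x, 0)) (frechet_derivative \<Phi> (at u) (0, z)) = 0"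
    for K
  proof -
    obtain D where D: "((\<lambda>u. K (\<Phi> u) (frechet_derivative \<Phi> (at u) (0, z)) (frechet_derivative \<Phi> (at u) (0, z))) has_derivative D) (at (x0, y0))"
      using form_along_has_derivative[OF S \<Gamma> K U(1,2,3) S0] by blast
    have "((\<lambda>x. (x, y0)) has_derivative (\<lambda>h. (h, 0))) (at x0)"
      by (auto intro!: derivative_eq_intros)
    from diff_chain_at[OF this D]
    have "((\<lambda>x. K (\<Phi> (x, y0)) (?d x z) (?d x z)) has_derivative (\<lambda>x. D (x, 0))) (at x0)"
      by (simp add: o_def)
    then show ?thesis
      using orthogonal_form_derivative[OF S \<Gamma> K U(1,2,3) S0 orth D] by simp
  qed
  let ?l = "\<lambda>v. - 2 * G (\<Phi> (x0, y0)) v ?n"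
  have dm: "((\<lambda>x. m x z z) has_derivative (\<lambda>x. ?l (?e x))) (at x0)"
    unfolding m_def by (rule der[OF G orthG])
  have dk: "((\<lambda>x. k x z z) has_derivative (\<lambda>x. ?l (j (?e x)))) (at x0)"
    unfolding k_def J(1)[symmetric] by (rule der[OF H orthH])
  have rel: "?l (j (?e x)) = l * ?l (?e x)" for x
    by (rule tight_quadratic_derivative[OF V _ dm dk eig l cb pos[OF U(3) z(1)]])
      (use ineq in \<open>auto simp: V_def\<close>)
  have zero: "?l (?e x) = 0" for x
  proof (rule ccontr)
    assume ne: "?l (?e x) \<noteq> 0"
    obtain x' where x': "j (?e x) = ?e x'" using inv by blast
    have bG: "bilinear (G (\<Phi> (x0, y0)))" by (rule bilS(1)[OF G U(3)])
    \<comment> \<open>As \<open>j\<close> maps base directions to base directions, \<open>rel\<close> applies to \<open>x\<close> and again to \<open>x'\<close>.\<close>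
    have "l * (l * ?l (?e x)) = ?l (j (j (?e x)))" using rel[of x] rel[of x'] x' by simp
    also have "\<dots> = a * ?l (j (?e x)) + b * ?l (?e x)"
      unfolding J(2) by (simp add: bilinear_ladd[OF bG] bilinear_lmul[OF bG])
    also have "\<dots> = (a * l + b) * ?l (?e x)" unfolding rel by (simp add: algebra_simps)
    finally have "(l * l - (a * l + b)) * ?l (?e x) = 0" by (simp add: algebra_simps)
    then have "l\<^sup>2 = a * l + b" using ne by (simp add: power2_eq_square)
    then have "(1 - c) * l\<^sup>2 = 0" using l by (simp add: algebra_simps)
    then have "l = 0" using c by simp
    then show False using l cb by auto
  qed
  have "((\<lambda>x. m x z z / \<mu> z z) has_derivative (\<lambda>_. 0)) (at x0)"
    using has_derivative_divide'[OF dm has_derivative_const, of "\<mu> z z"] \<mu>[OF z(1)] zero by simp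
  then show ?thesis
    by (rule has_derivative_transform_within_open[OF _ V])
      (use r \<mu>[OF z(1)] in \<open>auto simp: V_def m_def\<close>)
qed

section \<open>Differentials on products and their leaves\<close>

lemma differential_slice1:
  assumes A: "diff_atlas A" "c \<in> A" "x \<in> cdom c" and B: "diff_atlas B" "d \<in> B" "y \<in> cdom d"
  shows "differential A (prod_atlas A B) (\<lambda>x. (x, y)) x (coord_vec A c x v) =
    coord_vec (prod_atlas A B) (chart_prod c d) (x, y) (v, 0)"
proof -
  have ic: "is_chart c" using diff_atlasD(1) A by blast
  have h: "((\<lambda>u. (u, cmap d y)) has_derivative (\<lambda>v. (v, 0))) (at (cmap c x))"
    by (auto intro!: derivative_eq_intros)
  have "(cmap (chart_prod c d) \<circ> (\<lambda>x. (x, y)) \<circ> cinv c has_derivative (\<lambda>v. (v, 0))) (at (cmap c x))"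
  proof (rule has_derivative_transform_within_open[OF h])
    show "open (cmap c ` cdom c)" using ic by (simp add: is_chart_def)
    show "cmap c x \<in> cmap c ` cdom c" using A by blast
    show "(u, cmap d y) = (cmap (chart_prod c d) \<circ> (\<lambda>x. (x, y)) \<circ> cinv c) u" if "u \<in> cmap c ` cdom c" for u
      using chart_inverse(3)[OF ic that] by simp
  qed
  then show ?thesis
    by (intro differential_coord_vec[OF A prod_atlas_diff_atlas[OF A(1) B(1)] prod_atlasI[OF A(2) B(2)]])
      (use A B in \<open>auto intro!: continuous_intros\<close>)
qed

lemma differential_slice2:
  assumes A: "diff_atlas A" "c \<in> A" "x \<in> cdom c" and B: "diff_atlas B" "d \<in> B" "y \<in> cdom d"
  shows "differential B (prod_atlas A B) (\<lambda>y. (x, y)) y (coord_vec B d y v) =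
    coord_vec (prod_atlas A B) (chart_prod c d) (x, y) (0, v)"
proof -
  have id: "is_chart d" using diff_atlasD(1) B by blast
  have h: "((\<lambda>u. (cmap c x, u)) has_derivative (\<lambda>v. (0, v))) (at (cmap d y))"
    by (auto intro!: derivative_eq_intros)
  have "(cmap (chart_prod c d) \<circ> (\<lambda>y. (x, y)) \<circ> cinv d has_derivative (\<lambda>v. (0, v))) (at (cmap d y))"
  proof (rule has_derivative_transform_within_open[OF h])
    show "open (cmap d ` cdom d)" using id by (simp add: is_chart_def)
    show "cmap d y \<in> cmap d ` cdom d" using B by blast
    show "(cmap c x, u) = (cmap (chart_prod c d) \<circ> (\<lambda>y. (x, y)) \<circ> cinv d) u" if "u \<in> cmap d ` cdom d" for u
      using chart_inverse(3)[OF id that] by simp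
  qed
  then show ?thesis
    by (intro differential_coord_vec[OF B prod_atlas_diff_atlas[OF A(1) B(1)] prod_atlasI[OF A(2) B(2)]])
      (use A B in \<open>auto intro!: continuous_intros\<close>)
qed

lemma differential_projections:
  assumes A: "diff_atlas A" "c \<in> A" "x \<in> cdom c" and B: "diff_atlas B" "d \<in> B" "y \<in> cdom d"
  shows "differential (prod_atlas A B) A fst (x, y) (coord_vec (prod_atlas A B) (chart_prod c d) (x, y) w) =
      coord_vec A c x (fst w)"
    and "differential (prod_atlas A B) B snd (x, y) (coord_vec (prod_atlas A B) (chart_prod c d) (x, y) w) =
      coord_vec B d y (snd w)"
proof -
  have i: "is_chart c" "is_chart d" using diff_atlasD(1) A B by blast+
  let ?V = "cmap c ` cdom c \<times> cmap d ` cdom d"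
  have V: "open ?V" "(cmap c x, cmap d y) \<in> ?V"
    using i A(3) B(3) unfolding is_chart_def by (blast intro: open_Times)+
  note P = prod_atlas_diff_atlas[OF A(1) B(1)] prod_atlasI[OF A(2) B(2)]
  have xy: "(x, y) \<in> cdom (chart_prod c d)" using A B by simp
  have "(cmap c \<circ> fst \<circ> cinv (chart_prod c d) has_derivative fst) (at (cmap c x, cmap d y))"
    by (rule has_derivative_transform_within_open[OF bounded_linear_imp_has_derivative[OF bounded_linear_fst] V])
      (simp add: chart_prod_inverse[OF i, unfolded fst_conv snd_conv] chart_inverse(3)[OF i(1)] mem_Times_iff)
  then have "(cmap c \<circ> fst \<circ> cinv (chart_prod c d) has_derivative fst) (at (cmap (chart_prod c d) (x, y)))"
    by simp
  from differential_coord_vec[OF P xy A(1,2) _ _ this]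
  show "differential (prod_atlas A B) A fst (x, y) (coord_vec (prod_atlas A B) (chart_prod c d) (x, y) w) =
      coord_vec A c x (fst w)"
    using A(3) by (simp add: continuous_on_fst continuous_on_id)
  have "(cmap d \<circ> snd \<circ> cinv (chart_prod c d) has_derivative snd) (at (cmap c x, cmap d y))"
    by (rule has_derivative_transform_within_open[OF bounded_linear_imp_has_derivative[OF bounded_linear_snd] V])
      (simp add: chart_prod_inverse[OF i, unfolded fst_conv snd_conv] chart_inverse(3)[OF i(2)] mem_Times_iff)
  then have "(cmap d \<circ> snd \<circ> cinv (chart_prod c d) has_derivative snd) (at (cmap (chart_prod c d) (x, y)))"
    by simp
  from differential_coord_vec[OF P xy B(1,2) _ _ this]
  show "differential (prod_atlas A B) B snd (x, y) (coord_vec (prod_atlas A B) (chart_prod c d) (x, y) w) =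
      coord_vec B d y (snd w)"
    using B(3) by (simp add: continuous_on_snd continuous_on_id)
qed

text \<open>In product charts the leaf through \<open>y\<close> is a horizontal slice, so its differential is the restriction of
the full derivative \<open>L\<close> to vectors \<open>(v, 0)\<close>.\<close>

lemma differential_leaf1:
  assumes A: "diff_atlas A" "c \<in> A" "x \<in> cdom c" and B: "diff_atlas B" "d \<in> B" "y \<in> cdom d"
    and C: "diff_atlas C" "e \<in> C" "\<phi> (x, y) \<in> cdom e" and \<phi>: "continuous_on UNIV \<phi>"
    and L: "(cmap e \<circ> \<phi> \<circ> cinv (chart_prod c d) has_derivative L) (at (cmap c x, cmap d y))"
  shows "differential A C (\<lambda>x. \<phi> (x, y)) x (coord_vec A c x v) = coord_vec C e (\<phi> (x, y)) (L (v, 0))"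
proof -
  have i: "is_chart c" "is_chart d" using diff_atlasD(1) A B by blast+
  have h: "((\<lambda>u. (u, cmap d y)) has_derivative (\<lambda>v. (v, 0))) (at (cmap c x))"
    by (auto intro!: derivative_eq_intros)
  note ch = diff_chain_at[OF h L, unfolded o_def]
  have "(cmap e \<circ> (\<lambda>x. \<phi> (x, y)) \<circ> cinv c has_derivative (\<lambda>v. L (v, 0))) (at (cmap c x))"
  proof (rule has_derivative_transform_within_open[OF ch])
    show "open (cmap c ` cdom c)" using i by (simp add: is_chart_def)
    show "cmap c x \<in> cmap c ` cdom c" using A by blast
    show "cmap e (\<phi> (cinv (chart_prod c d) (u, cmap d y))) = (cmap e \<circ> (\<lambda>x. \<phi> (x, y)) \<circ> cinv c) u"
      if "u \<in> cmap c ` cdom c" for u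
      using chart_prod_inverse[OF i, of "(u, cmap d y)"] that B(3) chart_inverse(1)[OF i(2) B(3)] by simp
  qed
  then show ?thesis
    by (intro differential_coord_vec[OF A C(1,2)])
      (use C(3) in \<open>auto intro!: continuous_on_compose2[OF \<phi>] continuous_intros\<close>)
qed

lemma differential_leaf2:
  assumes A: "diff_atlas A" "c \<in> A" "x \<in> cdom c" and B: "diff_atlas B" "d \<in> B" "y \<in> cdom d"
    and C: "diff_atlas C" "e \<in> C" "\<phi> (x, y) \<in> cdom e" and \<phi>: "continuous_on UNIV \<phi>"
    and L: "(cmap e \<circ> \<phi> \<circ> cinv (chart_prod c d) has_derivative L) (at (cmap c x, cmap d y))"
  shows "differential B C (\<lambda>y. \<phi> (x, y)) y (coord_vec B d y v) = coord_vec C e (\<phi> (x, y)) (L (0, v))"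
proof -
  have i: "is_chart c" "is_chart d" using diff_atlasD(1) A B by blast+
  have h: "((\<lambda>u. (cmap c x, u)) has_derivative (\<lambda>v. (0, v))) (at (cmap d y))"
    by (auto intro!: derivative_eq_intros)
  note ch = diff_chain_at[OF h L, unfolded o_def]
  have "(cmap e \<circ> (\<lambda>y. \<phi> (x, y)) \<circ> cinv d has_derivative (\<lambda>v. L (0, v))) (at (cmap d y))"
  proof (rule has_derivative_transform_within_open[OF ch])
    show "open (cmap d ` cdom d)" using i by (simp add: is_chart_def)
    show "cmap d y \<in> cmap d ` cdom d" using B by blast
    show "cmap e (\<phi> (cinv (chart_prod c d) (cmap c x, u))) = (cmap e \<circ> (\<lambda>y. \<phi> (x, y)) \<circ> cinv d) u"
      if "u \<in> cmap d ` cdom d" for u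
      using chart_prod_inverse[OF i, of "(cmap c x, u)"] that A(3) chart_inverse(1)[OF i(1) A(3)] by simp
  qed
  then show ?thesis
    by (intro differential_coord_vec[OF B C(1,2)])
      (use C(3) in \<open>auto intro!: continuous_on_compose2[OF \<phi>] continuous_intros\<close>)
qed

text \<open>Fiber vectors have zero base component, so only the fiber term of the warped metric remains.\<close>

lemma warped_metric_fiber:
  assumes A: "diff_atlas A" "c \<in> A" "x \<in> cdom c" and B: "diff_atlas B" "d \<in> B" "y \<in> cdom d"
    and g: "riemannian_metric A g"
  shows "warped_metric A g B h f (x, y) (coord_vec (prod_atlas A B) (chart_prod c d) (x, y) (0, z))
      (coord_vec (prod_atlas A B) (chart_prod c d) (x, y) (0, w)) =
    (f x)\<^sup>2 * h y (coord_vec B d y z) (coord_vec B d y w)"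
proof -
  have 0: "coord_vec A c x 0 = 0" by (rule coord_vec_0[OF A])
  have T: "0 \<in> tangent_space A x" using coord_vec_tangent[OF A, of 0] 0 by simp
  have "g x 0 0 = 0" using riemannian_metricD(2)[OF g T T T, of 1] by simp
  then show ?thesis
    by (simp add: warped_metric_def differential_projections[OF A B] 0)
qed

section \<open>Constancy of the warping function\<close>

text \<open>Translates the geometric hypotheses into those of \<open>warping_derivative_zero\<close>, in product charts on the
warped product and a chart of the ambient manifold.\<close>

lemma warping_square_derivative:
  fixes B :: "('k::{t2_space, second_countable_topology}, 'c::euclidean_space) chart set"
    and A1 :: "('m::{t2_space, second_countable_topology}, 'a::euclidean_space) chart set"
    and A2 :: "('n::{t2_space, second_countable_topology}, 'b::euclidean_space) chart set"
  assumes lm: "locally_metallic B gb J"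
    and wp: "warped_product_pw_bi_slant A1 g1 A2 g2 f B gb J \<phi> \<theta>1 \<theta>2"
    and inv: "\<And>y. invariant_submanifold A1 B J (\<lambda>x. \<phi> (x, y))"
    and \<theta>: "\<And>y. \<theta>2 y \<in> {0<..<pi / 2}"
    and c1: "c1 \<in> A1" "x0 \<in> cdom c1"
  shows "((\<lambda>u. (f (cinv c1 u))\<^sup>2) has_derivative (\<lambda>_. 0)) (at (cmap c1 x0))"
proof -
  note w = wp[unfolded warped_product_pw_bi_slant_def]
  have A1: "smooth_manifold A1" "riemannian_metric A1 g1"
    using w[THEN conjunct1] by (simp_all add: riemannian_manifold_def)
  have A2: "smooth_manifold A2" "riemannian_metric A2 g2"
    using w[THEN conjunct2, THEN conjunct1] by (simp_all add: riemannian_manifold_def)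
  have fpos: "f x > 0" for x
    using w[THEN conjunct2, THEN conjunct2, THEN conjunct2, THEN conjunct1] by blast
  have bs: "pointwise_bi_slant (prod_atlas A1 A2) (warped_metric A1 g1 A2 g2 f) B gb J \<phi>
       (factor1_tangent A1 A2) (factor2_tangent A1 A2)"
    and sl: "\<And>x. pointwise_slant_submanifold A2 B gb J (\<lambda>y. \<phi> (x, y)) \<theta>2"
    using w by blast+
  have lm': "metallic_riemannian B gb J" using lm by (simp add: locally_metallic_def)
  have B: "smooth_manifold B" "riemannian_metric B gb"
    using lm'[unfolded metallic_riemannian_def, THEN conjunct1] by (simp_all add: riemannian_manifold_def)
  have gJ: "gb p (J p X) Y = gb p X (J p Y)"
    if "X \<in> tangent_space B p" "Y \<in> tangent_space B p" for p X Y
    using lm'[unfolded metallic_riemannian_def, THEN conjunct2, THEN conjunct2, THEN conjunct2, rule_format, OF that] .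
  note dA1 = smooth_manifold_diff_atlas[OF A1(1)] and dA2 = smooth_manifold_diff_atlas[OF A2(1)]
    and dB = smooth_manifold_diff_atlas[OF B(1)]
  let ?P = "prod_atlas A1 A2"
  have dP: "diff_atlas ?P" by (rule prod_atlas_diff_atlas[OF dA1 dA2])
  note bsc = bs[unfolded pointwise_bi_slant_def]
  note iso = bsc[THEN conjunct1, unfolded isometric_immersion_def]
  have sm: "smooth_map ?P B \<phi>" using iso by (simp add: immersion_def)
  have cont: "continuous_on UNIV \<phi>" using sm by (simp add: smooth_map_def)
  note isom = iso[THEN conjunct2, rule_format]
  have orth: "warped_metric A1 g1 A2 g2 f p X Y = 0"
    "gb (\<phi> p) (J (\<phi> p) (differential ?P B \<phi> p Y)) (differential ?P B \<phi> p X) = 0"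
    if "X \<in> factor1_tangent A1 A2 p" "Y \<in> factor2_tangent A1 A2 p" for p X Y
    using bsc[THEN conjunct2, THEN conjunct2, THEN conjunct2, THEN conjunct1, rule_format, THEN conjunct2,
        THEN conjunct2, rule_format, OF that] by blast+

  \<comment> \<open>\<open>f\<close> depends on the base only, so it suffices to look at the immersion near a single point of the fiber.\<close>
  define y0 :: 'n where "y0 = undefined"
  define c2 where "c2 = chart_at A2 y0"
  define d where "d = chart_at B (\<phi> (x0, y0))"
  have c2: "c2 \<in> A2" "y0 \<in> cdom c2" and d: "d \<in> B" "\<phi> (x0, y0) \<in> cdom d"
    using chart_at_in[OF dA2] chart_at_in[OF dB] by (simp_all add: c2_def d_def)
  have i1: "is_chart c1" and i2: "is_chart c2" and id: "is_chart d"
    using diff_atlasD(1) dA1 dA2 dB c1 c2 d by blast+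
  let ?e = "chart_prod c1 c2"
  have e: "?e \<in> ?P" by (rule prod_atlasI[OF c1(1) c2(1)])
  define \<Phi> where "\<Phi> = cmap d \<circ> \<phi> \<circ> cinv ?e"
  define S where "S = cmap d ` cdom d"
  define U where "U = cmap ?e ` (cdom ?e \<inter> \<phi> -` cdom d)"
  let ?D = "\<lambda>x y. frechet_derivative \<Phi> (at (cmap c1 x, cmap c2 y))"
  have ie: "is_chart ?e" by (rule prod_chart(1)[OF i1 i2])
  have S: "open S" using id by (simp add: S_def is_chart_def)
  have U: "open U" unfolding U_def
    by (rule chart_open_image[OF ie]) (use id cont in \<open>auto simp: is_chart_def intro: open_vimage\<close>)
  have smU: "smooth_on U \<Phi>"
    using sm e d(1) unfolding smooth_map_def U_def \<Phi>_def by blast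
  have Uin: "(cmap c1 x, cmap c2 y) \<in> U" if "x \<in> cdom c1" "y \<in> cdom c2" "\<phi> (x, y) \<in> cdom d" for x y
    unfolding U_def by (rule image_eqI[of _ _ "(x, y)"]) (use that in auto)
  have Uout: "\<exists>x y. u = (cmap c1 x, cmap c2 y) \<and> x \<in> cdom c1 \<and> y \<in> cdom c2 \<and> \<phi> (x, y) \<in> cdom d"
    if "u \<in> U" for u
    using that unfolding U_def by auto
  have \<Phi>: "\<Phi> (cmap c1 x, cmap c2 y) = cmap d (\<phi> (x, y))" if "x \<in> cdom c1" "y \<in> cdom c2" for x y
    using prod_chart(2)[OF i1 i2 that] by (simp add: \<Phi>_def)
  have D\<Phi>: "(cmap d \<circ> \<phi> \<circ> cinv ?e has_derivative ?D x y) (at (cmap c1 x, cmap c2 y))"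
    if "x \<in> cdom c1" "y \<in> cdom c2" "\<phi> (x, y) \<in> cdom d" for x y
    using smooth_on_has_derivative[OF smU Uin[OF that]] by (simp add: \<Phi>_def)
  have form: "coord_form B d K (\<Phi> (cmap c1 x, cmap c2 y)) v w =
      K (\<phi> (x, y)) (coord_vec B d (\<phi> (x, y)) v) (coord_vec B d (\<phi> (x, y)) w)"
    if "x \<in> cdom c1" "y \<in> cdom c2" "\<phi> (x, y) \<in> cdom d" for x y K v w
    using chart_inverse(1)[OF id that(3)] by (simp add: coord_form_def \<Phi>[OF that(1,2)])

  have dif: "differential ?P B \<phi> (x, y) (coord_vec ?P ?e (x, y) v) = coord_vec B d (\<phi> (x, y)) (?D x y v)"
    if "x \<in> cdom c1" "y \<in> cdom c2" "\<phi> (x, y) \<in> cdom d" for x y v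
    by (rule differential_coord_vec[OF dP e _ dB d(1) that(3) cont]) (use that D\<Phi>[OF that] in simp_all)
  have dif1: "differential A1 B (\<lambda>x. \<phi> (x, y)) x (coord_vec A1 c1 x v) = coord_vec B d (\<phi> (x, y)) (?D x y (v, 0))"
    if "x \<in> cdom c1" "y \<in> cdom c2" "\<phi> (x, y) \<in> cdom d" for x y v
    by (rule differential_leaf1[where \<phi> = \<phi>, OF dA1 c1(1) that(1) dA2 c2(1) that(2) dB d(1) that(3) cont D\<Phi>[OF that]])
  have dif2: "differential A2 B (\<lambda>y. \<phi> (x, y)) y (coord_vec A2 c2 y v) = coord_vec B d (\<phi> (x, y)) (?D x y (0, v))"
    if "x \<in> cdom c1" "y \<in> cdom c2" "\<phi> (x, y) \<in> cdom d" for x y v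
    by (rule differential_leaf2[where \<phi> = \<phi>, OF dA1 c1(1) that(1) dA2 c2(1) that(2) dB d(1) that(3) cont D\<Phi>[OF that]])
  have f1: "coord_vec ?P ?e (x, y) (v, 0) \<in> factor1_tangent A1 A2 (x, y)"
    and f2: "coord_vec ?P ?e (x, y) (0, z) \<in> factor2_tangent A1 A2 (x, y)"
    if "x \<in> cdom c1" "y \<in> cdom c2" for x y v z
    using differential_slice1[OF dA1 c1(1) that(1) dA2 c2(1) that(2), of v, symmetric]
      differential_slice2[OF dA1 c1(1) that(1) dA2 c2(1) that(2), of z, symmetric]
      coord_vec_tangent[OF dA1 c1(1) that(1), of v] coord_vec_tangent[OF dA2 c2(1) that(2), of z]
    unfolding factor1_tangent_def factor2_tangent_def fst_conv snd_conv by blast+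
  have PT: "coord_vec ?P ?e (x, y) v \<in> tangent_space ?P (x, y)" if "x \<in> cdom c1" "y \<in> cdom c2" for x y v
    by (rule coord_vec_tangent[OF dP e]) (use that in simp)
  have BT: "coord_vec B d q v \<in> tangent_space B q" if "q \<in> cdom d" for q v
    by (rule coord_vec_tangent[OF dB d(1) that])

  obtain \<Gamma> where \<Gamma>: "christoffel S \<Gamma>" "parallel_form S \<Gamma> (coord_form B d gb)"
    "parallel_form S \<Gamma> (coord_form B d (\<lambda>p X Y. gb p X (J p Y)))"
    using locally_metallic_coordinates[OF lm d(1)] unfolding S_def by blast
  obtain a b j where ab: "a > 0" "b > 0"
    and j: "\<And>q v. q \<in> cdom d \<Longrightarrow> J q (coord_vec B d q v) = coord_vec B d q (j q v)"
    "\<And>q. q \<in> cdom d \<Longrightarrow> linear (j q)"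
    "\<And>q v. q \<in> cdom d \<Longrightarrow> j q (j q v) = a *\<^sub>R j q v + b *\<^sub>R v"
    using metallic_operator_coordinates[OF lm d(1)] by blast
  let ?G = "coord_form B d gb" and ?H = "coord_form B d (\<lambda>p X Y. gb p X (J p Y))"
  have Hj: "?H (\<Phi> (cmap c1 x, cmap c2 y)) v w = ?G (\<Phi> (cmap c1 x, cmap c2 y)) (j (\<phi> (x, y)) v) w"
    if "x \<in> cdom c1" "y \<in> cdom c2" "\<phi> (x, y) \<in> cdom d" for x y v w
    unfolding form[OF that] j(1)[OF that(3), symmetric] by (rule gJ[symmetric, OF BT[OF that(3)] BT[OF that(3)]])
  let ?\<mu> = "\<lambda>z w. g2 y0 (coord_vec A2 c2 y0 z) (coord_vec A2 c2 y0 w)"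
  have met: "?G (\<Phi> (cmap c1 x, cmap c2 y)) (?D x y v) (?D x y w) =
      warped_metric A1 g1 A2 g2 f (x, y) (coord_vec ?P ?e (x, y) v) (coord_vec ?P ?e (x, y) w)"
    if "x \<in> cdom c1" "y \<in> cdom c2" "\<phi> (x, y) \<in> cdom d" for x y v w
    unfolding form[OF that] dif[OF that, symmetric] by (rule isom[OF PT[OF that(1,2)] PT[OF that(1,2)]])
  have fib: "?G (\<Phi> (cmap c1 x, cmap c2 y0)) (?D x y0 (0, z)) (?D x y0 (0, w)) = (f x)\<^sup>2 * ?\<mu> z w"
    if "x \<in> cdom c1" "\<phi> (x, y0) \<in> cdom d" for x z w
    unfolding met[OF that(1) c2(2) that(2)]
    by (rule warped_metric_fiber[OF dA1 c1(1) that(1) dA2 c2 A1(2)])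
  have \<mu>pos: "?\<mu> z z > 0" if "z \<noteq> 0" for z
    using riemannian_metricD(3)[OF A2(2) coord_vec_tangent[OF dA2 c2]] coord_vec_eq_0_iff[OF dA2 c2] that by blast
  have slice: "\<exists>x. u = cmap c1 x \<and> x \<in> cdom c1 \<and> \<phi> (x, y0) \<in> cdom d" if "(u, cmap c2 y0) \<in> U" for u
    using Uout[OF that] chart_inverse(1)[OF i2] c2(2) by (metis prod.inject)

  show ?thesis
  proof (rule warping_derivative_zero[OF S \<Gamma> U, where \<mu> = ?\<mu> and c = "(cos (\<theta>2 y0))\<^sup>2" and j = "j (\<phi> (x0, y0))"
        and ?y0.0 = "cmap c2 y0" and a = a and b = b])
    show "Ck_on 2 U \<Phi>" using smU by (simp add: smooth_on_def)
    show "(cmap c1 x0, cmap c2 y0) \<in> U" by (rule Uin[OF c1(2) c2(2) d(2)])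
    show "\<Phi> ` U \<subseteq> S"
    proof (rule image_subsetI)
      fix u assume "u \<in> U"
      then obtain x y where "u = (cmap c1 x, cmap c2 y)" "x \<in> cdom c1" "y \<in> cdom c2" "\<phi> (x, y) \<in> cdom d"
        using Uout by blast
      then show "\<Phi> u \<in> S" using \<Phi> by (simp add: S_def)
    qed
    show "?G (\<Phi> u) (frechet_derivative \<Phi> (at u) (x, 0)) (frechet_derivative \<Phi> (at u) (0, z)) = 0"
      if uU: "u \<in> U" for u x z
    proof -
      obtain p q where u: "u = (cmap c1 p, cmap c2 q)" and pq: "p \<in> cdom c1" "q \<in> cdom c2" "\<phi> (p, q) \<in> cdom d"
        using Uout[OF uU] by blast
      show ?thesis unfolding u met[OF pq] by (rule orth(1)[OF f1[OF pq(1,2)] f2[OF pq(1,2)]])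
    qed
    show "?H (\<Phi> u) (frechet_derivative \<Phi> (at u) (x, 0)) (frechet_derivative \<Phi> (at u) (0, z)) = 0"
      if uU: "u \<in> U" for u x z
    proof -
      obtain p q where u: "u = (cmap c1 p, cmap c2 q)" and pq: "p \<in> cdom c1" "q \<in> cdom c2" "\<phi> (p, q) \<in> cdom d"
        using Uout[OF uU] by blast
      have "?H (\<Phi> u) (frechet_derivative \<Phi> (at u) (x, 0)) (frechet_derivative \<Phi> (at u) (0, z)) =
          gb (\<phi> (p, q)) (J (\<phi> (p, q)) (coord_vec B d (\<phi> (p, q)) (?D p q (0, z)))) (coord_vec B d (\<phi> (p, q)) (?D p q (x, 0)))"
        unfolding u form[OF pq] j(1)[OF pq(3)]
        by (rule riemannian_metricD(1)[OF B(2) BT[OF pq(3)] BT[OF pq(3)]])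
      also have "\<dots> = 0"
        unfolding dif[OF pq, symmetric] by (rule orth(2)[OF f1[OF pq(1,2)] f2[OF pq(1,2)]])
      finally show ?thesis .
    qed
    show "?G (\<Phi> (u, cmap c2 y0)) (frechet_derivative \<Phi> (at (u, cmap c2 y0)) (0, z)) (frechet_derivative \<Phi> (at (u, cmap c2 y0)) (0, w)) =
        (f (cinv c1 u))\<^sup>2 * ?\<mu> z w" if "(u, cmap c2 y0) \<in> U" for u z w
    proof -
      obtain x where x: "u = cmap c1 x" "x \<in> cdom c1" "\<phi> (x, y0) \<in> cdom d" using slice[OF \<open>(u, cmap c2 y0) \<in> U\<close>] by blast
      show ?thesis unfolding x(1) fib[OF x(2,3)] chart_inverse(1)[OF i1 x(2)] ..
    qed
    show "f (cinv c1 u) > 0" for u by (rule fpos)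
    show "?\<mu> z z > 0" if "z \<noteq> 0" for z by (rule \<mu>pos[OF that])
    show "\<exists>T. \<forall>z w.
        ?G (\<Phi> (u, cmap c2 y0)) (frechet_derivative \<Phi> (at (u, cmap c2 y0)) (0, T z)) (frechet_derivative \<Phi> (at (u, cmap c2 y0)) (0, w)) =
        ?H (\<Phi> (u, cmap c2 y0)) (frechet_derivative \<Phi> (at (u, cmap c2 y0)) (0, z)) (frechet_derivative \<Phi> (at (u, cmap c2 y0)) (0, w)) \<and>
        ?G (\<Phi> (u, cmap c2 y0)) (frechet_derivative \<Phi> (at (u, cmap c2 y0)) (0, T z)) (frechet_derivative \<Phi> (at (u, cmap c2 y0)) (0, T z)) =
        (cos (\<theta>2 y0))\<^sup>2 * (a * ?H (\<Phi> (u, cmap c2 y0)) (frechet_derivative \<Phi> (at (u, cmap c2 y0)) (0, z)) (frechet_derivative \<Phi> (at (u, cmap c2 y0)) (0, z))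
           + b * ?G (\<Phi> (u, cmap c2 y0)) (frechet_derivative \<Phi> (at (u, cmap c2 y0)) (0, z)) (frechet_derivative \<Phi> (at (u, cmap c2 y0)) (0, z)))"
      if uU: "(u, cmap c2 y0) \<in> U" for u
    proof -
      obtain x where x: "u = cmap c1 x" "x \<in> cdom c1" "\<phi> (x, y0) \<in> cdom d" using slice[OF uU] by blast
      note pq = x(2) c2(2) x(3)
      let ?q = "\<phi> (x, y0)" and ?u = "(cmap c1 x, cmap c2 y0)"
      have uS: "\<Phi> ?u \<in> S" unfolding S_def using \<Phi>[OF x(2) c2(2)] x(3) by simp
      have lD: "linear (?D x y0)" using D\<Phi>[OF pq] has_derivative_linear by blast
      show ?thesis
        unfolding x(1) Hj[OF pq]
      proof (rule slant_projection[where E = "coord_vec B d ?q" and s = "gb ?q"])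
        show "linear (coord_vec B d ?q)"
          by (rule linear_scale_addI) (rule coord_vec_scale_add[OF dB d(1) x(3)])
        show "linear (\<lambda>z. ?D x y0 (0, z))"
          by (rule linear_scale_addI) (simp flip: linear_add[OF lD] linear_scale[OF lD])
        show "z = 0" if "?D x y0 (0, z) = 0" for z
        proof (rule ccontr)
          assume "z \<noteq> 0"
          then have "?G (\<Phi> ?u) (?D x y0 (0, z)) (?D x y0 (0, z)) > 0"
            using fib[OF x(2,3), of z z] \<mu>pos[of z] fpos[of x] by simp
          moreover have "bilinear (?G (\<Phi> ?u))" using \<Gamma>(2) uS by (simp add: parallel_form_def)
          ultimately show False by (simp add: that bilinear_lzero)
        qed
        show "bilinear (?G (\<Phi> ?u))" using \<Gamma>(2) uS by (simp add: parallel_form_def)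
        show sG: "?G (\<Phi> ?u) v w = ?G (\<Phi> ?u) w v" for v w
          using \<Gamma>(2) uS unfolding parallel_form_def by blast
        show "?G (\<Phi> ?u) v v > 0" if "v \<noteq> 0" for v
          unfolding form[OF pq]
          using riemannian_metricD(3)[OF B(2) BT[OF x(3)]] coord_vec_eq_0_iff[OF dB d(1) x(3)] that by blast
        show "gb ?q (coord_vec B d ?q v) (coord_vec B d ?q w) = ?G (\<Phi> ?u) v w" for v w
          by (rule form[OF pq, symmetric])
        show "linear (j ?q)" by (rule j(2)[OF x(3)])
        show "?G (\<Phi> ?u) (j ?q v) w = ?G (\<Phi> ?u) v (j ?q w)" for v w
          unfolding form[OF pq] j(1)[OF x(3), symmetric] by (rule gJ[OF BT[OF x(3)] BT[OF x(3)]])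
        show "j ?q (j ?q v) = a *\<^sub>R j ?q v + b *\<^sub>R v" for v by (rule j(3)[OF x(3)])
        show "b > 0" by (rule ab(2))
        show "subspace_angle (gb ?q) (range (\<lambda>z. coord_vec B d ?q (?D x y0 (0, z))))
            (coord_vec B d ?q (j ?q (?D x y0 (0, z)))) = \<theta>2 y0" if "z \<noteq> 0" for z
        proof -
          let ?X = "coord_vec A2 c2 y0 z"
          have X: "?X \<in> tangent_space A2 y0" "?X \<noteq> 0"
            using coord_vec_tangent[OF dA2 c2] coord_vec_eq_0_iff[OF dA2 c2] that by blast+
          have "subspace_angle (gb ?q) (differential A2 B (\<lambda>y. \<phi> (x, y)) y0 ` tangent_space A2 y0)
             (J ?q (differential A2 B (\<lambda>y. \<phi> (x, y)) y0 ?X)) = \<theta>2 y0"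
            using sl[of x] X unfolding pointwise_slant_submanifold_def pointwise_slant_distribution_def by blast
          moreover have "differential A2 B (\<lambda>y. \<phi> (x, y)) y0 ` tangent_space A2 y0 =
              range (\<lambda>z. coord_vec B d ?q (?D x y0 (0, z)))"
            unfolding tangent_space_eq_range[OF dA2 c2] image_image dif2[OF pq] ..
          ultimately show ?thesis unfolding dif2[OF pq] j(1)[OF x(3)] by simp
        qed
      qed
    qed
    have cs: "0 < cos (\<theta>2 y0)" "cos (\<theta>2 y0) < 1"
      using \<theta>[of y0] cos_gt_zero[of "\<theta>2 y0"] cos_monotone_0_pi[of 0 "\<theta>2 y0"] by auto
    show "0 < (cos (\<theta>2 y0))\<^sup>2" "(cos (\<theta>2 y0))\<^sup>2 < 1"
      using cs by (simp_all add: power_less_one_iff)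
    show "b > 0" by (rule ab(2))
    show "?H (\<Phi> (cmap c1 x0, cmap c2 y0)) v w = ?G (\<Phi> (cmap c1 x0, cmap c2 y0)) (j (\<phi> (x0, y0)) v) w" for v w
      by (rule Hj[OF c1(2) c2(2) d(2)])
    show "j (\<phi> (x0, y0)) (j (\<phi> (x0, y0)) v) = a *\<^sub>R j (\<phi> (x0, y0)) v + b *\<^sub>R v" for v
      by (rule j(3)[OF d(2)])
    show "\<exists>x'. j (\<phi> (x0, y0)) (?D x0 y0 (x, 0)) = ?D x0 y0 (x', 0)" for x
    proof -
      note pq = c1(2) c2(2) d(2)
      have "J (\<phi> (x0, y0)) (differential A1 B (\<lambda>x. \<phi> (x, y0)) x0 (coord_vec A1 c1 x0 x)) \<in>
          differential A1 B (\<lambda>x. \<phi> (x, y0)) x0 ` tangent_space A1 x0"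
        using inv[of y0] coord_vec_tangent[OF dA1 c1] unfolding invariant_submanifold_def by blast
      then obtain x' where "coord_vec B d (\<phi> (x0, y0)) (j (\<phi> (x0, y0)) (?D x0 y0 (x, 0))) =
          coord_vec B d (\<phi> (x0, y0)) (?D x0 y0 (x', 0))"
        unfolding tangent_space_eq_range[OF dA1 c1] image_image dif1[OF pq] j(1)[OF d(2)] by blast
      from fun_cong[OF this, of d] show ?thesis
        unfolding coord_vec_same[OF dB d] by blast
    qed
  qed
qed

lemma locally_constant_of_chart_derivative_zero:
  fixes h :: "'m::topological_space \<Rightarrow> real"
  assumes A: "diff_atlas A"
    and d0: "\<And>c x. c \<in> A \<Longrightarrow> x \<in> cdom c \<Longrightarrow> ((\<lambda>u. h (cinv c u)) has_derivative (\<lambda>_. 0)) (at (cmap c x))"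
  shows "\<exists>N. open N \<and> x \<in> N \<and> (\<forall>y\<in>N. h y = h x)"
proof -
  define c where "c = chart_at A x"
  have c: "c \<in> A" "x \<in> cdom c" using chart_at_in[OF A] by (simp_all add: c_def)
  have ic: "is_chart c" by (rule diff_atlasD(1)[OF A c(1)])
  obtain r where r: "r > 0" "ball (cmap c x) r \<subseteq> cmap c ` cdom c"
    using ic c(2) unfolding is_chart_def by (meson imageI open_contains_ball)
  have "((\<lambda>u. h (cinv c u)) has_derivative (\<lambda>_. 0)) (at u within ball (cmap c x) r)"
    if u: "u \<in> ball (cmap c x) r" for u
  proof -
    obtain y where "u = cmap c y" "y \<in> cdom c" using r(2) u by blast
    then show ?thesis using d0[OF c(1)] by (auto intro: has_derivative_at_withinI)
  qed
  from has_derivative_zero_constant[OF convex_ball this]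
  obtain k where k: "\<And>u. u \<in> ball (cmap c x) r \<Longrightarrow> h (cinv c u) = k"
    by blast
  define N where "N = cdom c \<inter> cmap c -` ball (cmap c x) r"
  have "open N"
    unfolding N_def using ic by (auto simp: is_chart_def homeomorphism_def intro: continuous_open_preimage)
  moreover have "x \<in> N" using c r by (simp add: N_def)
  moreover have "h y = h x" if "y \<in> N" for y
    using k[of "cmap c y"] k[of "cmap c x"] that r(1) c(2) chart_inverse(1)[OF ic] by (simp add: N_def)
  ultimately show ?thesis by blast
qed

theorem theorem6p2:
  fixes B :: "('k::{t2_space, second_countable_topology}, 'c::euclidean_space) chart set"
    and gb :: "'k \<Rightarrow> ('k, 'c) tvec \<Rightarrow> ('k, 'c) tvec \<Rightarrow> real"
    and J :: "'k \<Rightarrow> ('k, 'c) tvec \<Rightarrow> ('k, 'c) tvec"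
    and A1 :: "('m::{t2_space, second_countable_topology}, 'a::euclidean_space) chart set"
    and g1 :: "'m \<Rightarrow> ('m, 'a) tvec \<Rightarrow> ('m, 'a) tvec \<Rightarrow> real"
    and A2 :: "('n::{t2_space, second_countable_topology}, 'b::euclidean_space) chart set"
    and g2 :: "'n \<Rightarrow> ('n, 'b) tvec \<Rightarrow> ('n, 'b) tvec \<Rightarrow> real"
    and f :: "'m \<Rightarrow> real"
    and \<phi> :: "'m \<times> 'n \<Rightarrow> 'k"
    and \<theta>1 :: "'m \<Rightarrow> real" and \<theta>2 :: "'n \<Rightarrow> real"
  assumes "locally_metallic B gb J"
    and "warped_product_pw_semi_slant A1 g1 A2 g2 f B gb J \<phi> \<theta>1 \<theta>2"
    and "\<forall>y. invariant_submanifold A1 B J (\<lambda>x. \<phi> (x, y))"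
    and "\<forall>y. \<theta>2 y \<in> {0<..<pi / 2}"
  shows "\<forall>C \<in> components (UNIV :: 'm set). f constant_on C"
proof
  have wp: "warped_product_pw_bi_slant A1 g1 A2 g2 f B gb J \<phi> \<theta>1 \<theta>2"
    using assms(2) by (simp add: warped_product_pw_semi_slant_def)
  have A: "diff_atlas A1" and f: "f x > 0" for x
    using wp smooth_manifold_diff_atlas
    by (auto simp: warped_product_pw_bi_slant_def riemannian_manifold_def)
  have sq: "\<exists>N. open N \<and> x \<in> N \<and> (\<forall>y\<in>N. (f y)\<^sup>2 = (f x)\<^sup>2)" for x
    by (rule locally_constant_of_chart_derivative_zero[OF A])
      (use warping_square_derivative[OF assms(1) wp] assms(3,4) in blast)
  have root: "f y = f x" if "(f y)\<^sup>2 = (f x)\<^sup>2" for x y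
    using that f[of x] f[of y] by (simp add: power2_eq_iff_nonneg less_imp_le)
  have loc: "\<exists>N. open N \<and> x \<in> N \<and> (\<forall>y\<in>N. f y = f x)" for x
    using sq[of x] root by (elim ex_forward) blast
  fix C :: "'m set" assume "C \<in> components UNIV"
  then have C: "connected C" by (rule in_components_connected)
  have ev: "\<forall>x\<in>C. \<forall>\<^sub>F y in at x within C. f x = f y"
  proof
    fix x
    obtain N where "open N" "x \<in> N" "\<forall>y\<in>N. f y = f x" using loc by blast
    then show "\<forall>\<^sub>F y in at x within C. f x = f y"
      unfolding eventually_at_topological by metis
  qed
  show "f constant_on C"
    unfolding constant_on_def using connected_local_const[OF C _ _ ev] by blast
qed

end
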